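(* Let $\mathcal{A}=\bigoplus_{k=1}^N\mathcal{M}_{d_k}$. For each $k\in\{1,\ldots,N\}$ let $\lambda_k=(n_{k,1}^{m_{k,1}},\ldots,n_{k,L_k}^{m_{k,L_k}})$ be a refined partition of $d_k$ with corresponding subalgebra $\mathcal{B}_{\lambda_k}\subseteq\mathcal{M}_{d_k}$, and set $\mathcal{B}=\bigoplus_{k=1}^N\mathcal{B}_{\lambda_k}$. Let $\mathbf{v}=(v_1,\ldots,v_N)\in(0,1)^N$ with $\sum_{k=1}^N v_k=1$ (with $\mathbf{v}=(1)$ when $N=1$). Set $\ell=\mathrm{lcm}\{m_{k,i}:1\le k\le N,\ 1\le i\le L_k\}$ and $r=\mathrm{lcm}\{r_1,\ldots,r_N\}$, where $r_k=\sum_{i=1}^{L_k}m_{k,i}$ is the number of diagonal blocks of $\mathcal{B}$ in the $k$th summand of $\mathcal{A}$. If $X\in\mathcal{A}$ is positive, then \[ \|P^{\mathbf{v}}_{\mathcal{B}}(X)\|_{\mathrm{op}}\ge\frac{1}{r\ell}\|X\|_{\mathrm{op}}, \] and, moreover, \[ \frac{1}{\sqrt{r\ell}}\|X\|_{\mathrm{op}}\le\|X\|_{\mathbf{v},\mathcal{B}} \] for all $X\in\mathcal{A}$.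
   Context: $\mathcal{M}_n$ is the C*-algebra of complex $n\times n$ matrices with the operator norm. $\bigoplus_{k=1}^N\mathcal{M}_{d_k}$ ($N,d_k\in\{1,2,\ldots\}$) is a unital C*-algebra with coordinatewise operations; its norm $\|\cdot\|_{\mathrm{op}}$ is the maximum of the operator norms of the coordinates; elements are written $A=(A^{(1)},\ldots,A^{(N)})$. Positive means every coordinate is positive semidefinite. A refined partition of $n$ is a formal expression $\lambda=(n_1^{m_1},\ldots,n_L^{m_L})$ with $L,n_i,m_i\in\{1,2,\ldots\}$ and $n=\sum_i m_in_i$ (the $n_i$ need not be distinct). The corresponding subalgebra is $\mathcal{B}_\lambda=\bigoplus_{i=1}^L(I_{m_i}\otimes\mathcal{M}_{n_i})\subseteq\mathcal{M}_n$, i.e. the block-diagonal matrices $\mathrm{diag}(A_1,\ldots,A_1,\ldots,A_L,\ldots,A_L)$ with $A_i\in\mathcal{M}_{n_i}$ repeated $m_i$ times. For $\mathbf{v}$ as in the claim, $\tau_{\mathbf{v}}(A)=\sum_{k=1}^N\frac{v_k}{d_k}\mathrm{Tr}(A^{(k)})$ is a faithful tracial state. $P^{\mathbf{v}}_{\mathcal{B}}:\mathcal{A}\to\mathcal{B}$ is the unique conditional expectation onto $\mathcal{B}$ (linear map $P$ with $P(B)=B$ for $B\in\mathcal{B}$ and $\|P(A)\|_{\mathrm{op}}\le\|A\|_{\mathrm{op}}$) with $\tau_{\mathbf{v}}\circ P^{\mathbf{v}}_{\mathcal{B}}=\tau_{\mathbf{v}}$; equivalently, the orthogonal projection onto $\mathcal{B}$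 for the inner product $\langle A,B\rangle=\tau_{\mathbf{v}}(B^*A)$. The Frobenius--Rieffel norm is $\|A\|_{\mathbf{v},\mathcal{B}}=\sqrt{\|P^{\mathbf{v}}_{\mathcal{B}}(A^*A)\|_{\mathrm{op}}}$. *)

theory Defs
  imports
    "HOL-Analysis.L2_Norm"
    "HOL-Library.FuncSet"
    "Jordan_Normal_Form.Schur_Decomposition"
begin

subsection \<open>A single matrix\<close>

definition vec_l2norm :: "complex vec \<Rightarrow> real" where
  "vec_l2norm x = L2_set (\<lambda>i. cmod (x $ i)) {..<dim_vec x}"

definition mat_opnorm :: "complex mat \<Rightarrow> real" where
  "mat_opnorm A = (SUP x\<in>{x \<in> carrier_vec (dim_col A). vec_l2norm x \<le> 1}. vec_l2norm (A *\<^sub>v x))"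

definition mat_trace :: "complex mat \<Rightarrow> complex" where
  "mat_trace A = (\<Sum>i<dim_row A. A $$ (i, i))"

text \<open>The order on \<^typ>\<open>complex\<close> is that of \<^theory>\<open>HOL-Library.Complex_Order\<close>: \<open>0 \<le> z\<close> means that
  \<open>z\<close> is real and nonnegative. So the condition below forces \<open>A\<close> to be Hermitian.\<close>

definition psd :: "complex mat \<Rightarrow> bool" where
  "psd A \<longleftrightarrow> square_mat A \<and> (\<forall>x\<in>carrier_vec (dim_row A). 0 \<le> (A *\<^sub>v x) \<bullet>c x)"

subsection \<open>Direct sums of matrix algebras\<close>

text \<open>An element \<open>(X\<^sup>1, \<dots>, X\<^sup>N)\<close> of the direct sum is a function on \<open>{1..N}\<close>, taken to be
  \<^const>\<open>undefined\<close> elsewhere, so that equality of functions is equality in the algebra.\<close>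

type_synonym mats = "nat \<Rightarrow> complex mat"

definition dsum :: "nat \<Rightarrow> (nat \<Rightarrow> nat) \<Rightarrow> mats set" where
  "dsum N d = (\<Pi>\<^sub>E k\<in>{1..N}. carrier_mat (d k) (d k))"

definition ds_add :: "nat \<Rightarrow> mats \<Rightarrow> mats \<Rightarrow> mats" where
  "ds_add N X Y = (\<lambda>k\<in>{1..N}. X k + Y k)"

definition ds_smult :: "nat \<Rightarrow> complex \<Rightarrow> mats \<Rightarrow> mats" where
  "ds_smult N c X = (\<lambda>k\<in>{1..N}. c \<cdot>\<^sub>m X k)"

definition ds_mult :: "nat \<Rightarrow> mats \<Rightarrow> mats \<Rightarrow> mats" where
  "ds_mult N X Y = (\<lambda>k\<in>{1..N}. X k * Y k)"

definition ds_adjoint :: "nat \<Rightarrow> mats \<Rightarrow> mats" where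
  "ds_adjoint N X = (\<lambda>k\<in>{1..N}. mat_adjoint (X k))"

definition ds_opnorm :: "nat \<Rightarrow> mats \<Rightarrow> real" where
  "ds_opnorm N X = (MAX k\<in>{1..N}. mat_opnorm (X k))"

definition ds_positive :: "nat \<Rightarrow> mats \<Rightarrow> bool" where
  "ds_positive N X \<longleftrightarrow> (\<forall>k\<in>{1..N}. psd (X k))"

definition tau :: "nat \<Rightarrow> (nat \<Rightarrow> nat) \<Rightarrow> (nat \<Rightarrow> real) \<Rightarrow> mats \<Rightarrow> complex" where
  "tau N d v X = (\<Sum>k=1..N. complex_of_real (v k / real (d k)) * mat_trace (X k))"

subsection \<open>Refined partitions and their block-diagonal subalgebras\<close>

text \<open>The refined partition \<open>(n\<^sub>1\<^bsup>m\<^sub>1\<^esup>, \<dots>, n\<^sub>L\<^bsup>m\<^sub>L\<^esup>)\<close> is the list of the pairs \<open>(n\<^sub>i, m\<^sub>i)\<close>,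
  block size first and multiplicity second.\<close>

type_synonym rpart = "(nat \<times> nat) list"

definition refined_partition :: "rpart \<Rightarrow> nat \<Rightarrow> bool" where
  "refined_partition p n \<longleftrightarrow>
     p \<noteq> [] \<and> (\<forall>(ni, mi)\<in>set p. 1 \<le> ni \<and> 1 \<le> mi) \<and> n = (\<Sum>(ni, mi)\<leftarrow>p. mi * ni)"

definition block_subalgebra :: "rpart \<Rightarrow> complex mat set" where
  "block_subalgebra p =
     {diag_block_mat (concat (map2 (\<lambda>(ni, mi) A. replicate mi A) p As)) | As.
        length As = length p \<and> (\<forall>i<length p. As ! i \<in> carrier_mat (fst (p ! i)) (fst (p ! i)))}"

definition ds_subalgebra :: "nat \<Rightarrow> (nat \<Rightarrow> rpart) \<Rightarrow> mats set" where
  "ds_subalgebra N lam = (\<Pi>\<^sub>E k\<in>{1..N}. block_subalgebra (lam k))"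

subsection \<open>Conditional expectations and the Frobenius--Rieffel norm\<close>

definition cond_expectation ::
    "nat \<Rightarrow> (nat \<Rightarrow> nat) \<Rightarrow> mats set \<Rightarrow> (mats \<Rightarrow> mats) \<Rightarrow> bool" where
  "cond_expectation N d B P \<longleftrightarrow>
     P \<in> dsum N d \<rightarrow>\<^sub>E B \<and>
     (\<forall>X\<in>dsum N d. \<forall>Y\<in>dsum N d. P (ds_add N X Y) = ds_add N (P X) (P Y)) \<and>
     (\<forall>c. \<forall>X\<in>dsum N d. P (ds_smult N c X) = ds_smult N c (P X)) \<and>
     (\<forall>X\<in>B. P X = X) \<and>
     (\<forall>X\<in>dsum N d. ds_opnorm N (P X) \<le> ds_opnorm N X)"

text \<open>For a unital *-subalgebra \<open>B\<close> and positive weights \<open>v\<close> there is exactly one conditional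
  expectation onto \<open>B\<close> that preserves \<open>tau N d v\<close>. The extensional function space in
  \<^const>\<open>cond_expectation\<close> is what makes it unique as a HOL function.\<close>

definition cond_exp ::
    "nat \<Rightarrow> (nat \<Rightarrow> nat) \<Rightarrow> (nat \<Rightarrow> real) \<Rightarrow> mats set \<Rightarrow> mats \<Rightarrow> mats" where
  "cond_exp N d v B =
     (THE P. cond_expectation N d B P \<and> (\<forall>X\<in>dsum N d. tau N d v (P X) = tau N d v X))"

definition FR_norm ::
    "nat \<Rightarrow> (nat \<Rightarrow> nat) \<Rightarrow> (nat \<Rightarrow> real) \<Rightarrow> mats set \<Rightarrow> mats \<Rightarrow> real" where
  "FR_norm N d v B X = sqrt (ds_opnorm N (cond_exp N d v B (ds_mult N (ds_adjoint N X) X)))"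

end

(* The averages of the diagonal blocks of equal type define a contractive, trace-preserving projection
   E onto B. If X is positive with R diagonal blocks X_jj, then <X x, x> <= R * sum_j <X_jj x_j, x_j>,
   and X_jj is at most m times the corresponding average over m blocks; this gives
   ||X|| <= R m ||E X||, and X* X in place of X gives the second claim.

   It remains to see that E is the only trace-preserving conditional expectation. Let P be another one
   and q in B a projection. The functional X |-> tau(q P(X)) has norm tau(q) and attains it at q. Since
   ||c q + Y||^2 <= |c|^2 + ||Y||^2 whenever Y q = 0 or q Y = 0, it vanishes on all such Y. Applied to
   q and to 1 - q, this yields tau(q P(X)) = tau(P(q X q)) = tau(q X), and the projections of B
   separate the points of B. *)

theory Submission
  imports Defs
begin

subsection \<open>Operator norm and quadratic forms\<close>

text \<open>\<open>cond_exp\<close> is a definite description, so nothing can be said about it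
  before existence and uniqueness are both known. Its defining properties are linearity,
  contractivity, fixing \<open>B\<close> and preserving \<open>tau\<close>; positivity and
  \<open>B\<close>-bilinearity are not among them (in general they follow by Tomiyama's theorem). A
  competitor of E is therefore not at once recognizable as the orthogonal projection, and testing
  against projections of \<open>B\<close> replaces bilinearity. E preserves the trace of every
  summand, hence \<open>tau\<close> for any weights. Strict positivity of \<open>v\<close> serves
  uniqueness, where the trace of a single summand is recovered from \<open>tau\<close>. In summand k
  the estimate produces the number r_k of blocks and a multiplicity m_{k,i}. A positive lcm
  dominates its members, so r_k \<le> r and m_{k,i} \<le> l give one factor common to all summands.
  Coordinates are labelled by pairs (block, offset). This makes the block algebra and the block
  average explicit formulas for entries.\<close>

text \<open>Vectors are functions of which only the values below the dimension \<open>n\<close> matter.\<close>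

definition ip :: "nat \<Rightarrow> (nat \<Rightarrow> complex) \<Rightarrow> (nat \<Rightarrow> complex) \<Rightarrow> complex" where
  "ip n x y = (\<Sum>s<n. x s * cnj (y s))"

definition fnorm :: "nat \<Rightarrow> (nat \<Rightarrow> complex) \<Rightarrow> real" where
  "fnorm n x = L2_set (\<lambda>s. cmod (x s)) {..<n}"

text \<open>At a row index beyond the dimension the entry \<open>A $$ (s, t)\<close> is unspecified.
  Identities that change the matrix therefore carry \<open>s < n\<close> or pass through
  \<open>ip_cong\<close> and \<open>fnorm_cong\<close>.\<close>

definition mv :: "complex mat \<Rightarrow> (nat \<Rightarrow> complex) \<Rightarrow> nat \<Rightarrow> complex" where
  "mv A x = (\<lambda>s. \<Sum>t<dim_col A. A $$ (s, t) * x t)"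

lemma ip_cong: "(\<And>s. s < n \<Longrightarrow> x s = x' s) \<Longrightarrow> (\<And>s. s < n \<Longrightarrow> y s = y' s) \<Longrightarrow> ip n x y = ip n x' y'"
  unfolding ip_def by (intro sum.cong) auto

lemma fnorm_cong: "(\<And>s. s < n \<Longrightarrow> x s = x' s) \<Longrightarrow> fnorm n x = fnorm n x'"
  unfolding fnorm_def by (intro L2_set_cong) auto

lemma mv_cong: "dim_col A = n \<Longrightarrow> (\<And>s. s < n \<Longrightarrow> x s = x' s) \<Longrightarrow> mv A x = mv A x'"
  unfolding mv_def by (intro ext sum.cong) auto

lemma ip_add_left: "ip n (\<lambda>s. x s + y s) z = ip n x z + ip n y z"
  by (simp add: ip_def algebra_simps sum.distrib)

lemma ip_add_right: "ip n z (\<lambda>s. x s + y s) = ip n z x + ip n z y"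
  by (simp add: ip_def algebra_simps sum.distrib)

lemma ip_diff_left: "ip n (\<lambda>s. x s - y s) z = ip n x z - ip n y z"
  by (simp add: ip_def algebra_simps sum_subtractf)

lemma ip_diff_right: "ip n z (\<lambda>s. x s - y s) = ip n z x - ip n z y"
  by (simp add: ip_def algebra_simps sum_subtractf)

lemma ip_scale_left: "ip n (\<lambda>s. c * x s) z = c * ip n x z"
  by (simp add: ip_def algebra_simps sum_distrib_left)

lemma ip_scale_right: "ip n z (\<lambda>s. c * x s) = cnj c * ip n z x"
  by (simp add: ip_def algebra_simps sum_distrib_left)

lemma ip_sum_left: "ip n (\<lambda>s. \<Sum>i\<in>I. f i s) z = (\<Sum>i\<in>I. ip n (f i) z)"
  unfolding ip_def by (simp add: sum_distrib_right) (rule sum.swap)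

lemma ip_sum_right: "ip n z (\<lambda>s. \<Sum>i\<in>I. f i s) = (\<Sum>i\<in>I. ip n z (f i))"
  unfolding ip_def by (simp add: sum_distrib_left) (rule sum.swap)

lemma ip_cnj: "cnj (ip n x y) = ip n y x"
  by (simp add: ip_def mult.commute)

lemma ip_self: "ip n x x = of_real ((fnorm n x)\<^sup>2)"
  by (simp add: ip_def fnorm_def L2_set_def sum_nonneg flip: complex_norm_square)

lemma fnorm_nonneg [simp]: "0 \<le> fnorm n x"
  by (simp add: fnorm_def)

lemma fnorm_scale: "fnorm n (\<lambda>s. c * x s) = cmod c * fnorm n x"
  by (simp add: fnorm_def norm_mult L2_set_right_distrib)

lemma fnorm_triangle: "fnorm n (\<lambda>s. x s + y s) \<le> fnorm n x + fnorm n y"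
proof -
  have "fnorm n (\<lambda>s. x s + y s) \<le> L2_set (\<lambda>s. cmod (x s) + cmod (y s)) {..<n}"
    unfolding fnorm_def by (intro L2_set_mono norm_triangle_ineq) auto
  also have "\<dots> \<le> fnorm n x + fnorm n y"
    unfolding fnorm_def by (rule L2_set_triangle_ineq)
  finally show ?thesis .
qed

lemma ip_Cauchy_Schwarz: "cmod (ip n x y) \<le> fnorm n x * fnorm n y"
proof -
  have "cmod (ip n x y) \<le> (\<Sum>s<n. cmod (x s) * cmod (y s))"
    unfolding ip_def by (rule order_trans[OF norm_sum]) (simp add: norm_mult)
  also have "\<dots> \<le> fnorm n x * fnorm n y"
    unfolding fnorm_def using L2_set_mult_ineq[of "\<lambda>s. cmod (x s)" "\<lambda>s. cmod (y s)"] by simp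
  finally show ?thesis .
qed

lemma mv_add: "mv A (\<lambda>s. x s + y s) = (\<lambda>s. mv A x s + mv A y s)"
  by (simp add: mv_def algebra_simps sum.distrib)

lemma mv_diff: "mv A (\<lambda>s. x s - y s) = (\<lambda>s. mv A x s - mv A y s)"
  by (simp add: mv_def algebra_simps sum_subtractf)

lemma mv_scale: "mv A (\<lambda>s. c * x s) = (\<lambda>s. c * mv A x s)"
  by (simp add: mv_def algebra_simps sum_distrib_left)

lemma mv_sum: "mv A (\<lambda>s. \<Sum>i\<in>I. f i s) = (\<lambda>s. \<Sum>i\<in>I. mv A (f i) s)"
  unfolding mv_def by (simp add: sum_distrib_left) (intro ext sum.swap)

lemma mv_mult:
  assumes "A \<in> carrier_mat n m" "B \<in> carrier_mat m p" "s < n"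
  shows "mv (A * B) x s = mv A (mv B x) s"
proof -
  have "mv (A * B) x s = (\<Sum>t<p. \<Sum>u<m. A $$ (s, u) * B $$ (u, t) * x t)"
    using assms by (auto simp: mv_def scalar_prod_def sum_distrib_right atLeast0LessThan intro!: sum.cong)
  also have "\<dots> = (\<Sum>u<m. \<Sum>t<p. A $$ (s, u) * B $$ (u, t) * x t)"
    by (rule sum.swap)
  also have "\<dots> = mv A (mv B x) s"
    using assms by (auto simp: mv_def sum_distrib_left algebra_simps intro!: sum.cong)
  finally show ?thesis .
qed

lemma mat_adjoint_carrier [simp]: "A \<in> carrier_mat n m \<Longrightarrow> mat_adjoint A \<in> carrier_mat m n"
  by (auto simp: mat_adjoint_def)

lemma mat_adjoint_index: "A \<in> carrier_mat n m \<Longrightarrow> s < m \<Longrightarrow> t < n \<Longrightarrow> mat_adjoint A $$ (s, t) = cnj (A $$ (t, s))"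
  by (auto simp: mat_adjoint_def mat_of_rows_def)

lemma ip_mv_adjoint:
  assumes "A \<in> carrier_mat n n"
  shows "ip n (mv A x) y = ip n x (mv (mat_adjoint A) y)"
proof -
  have "mat_adjoint A \<in> carrier_mat n n" using assms by simp
  then have "ip n x (mv (mat_adjoint A) y) = (\<Sum>s<n. \<Sum>t<n. x s * (A $$ (t, s) * cnj (y t)))"
    using assms by (auto simp: ip_def mv_def mat_adjoint_index sum_distrib_left simp del: mat_adjoint_carrier intro!: sum.cong)
  also have "\<dots> = (\<Sum>t<n. \<Sum>s<n. x s * (A $$ (t, s) * cnj (y t)))"
    by (rule sum.swap)
  also have "\<dots> = ip n (mv A x) y"
    using assms by (auto simp: ip_def mv_def sum_distrib_left sum_distrib_right algebra_simps intro!: sum.cong)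
  finally show ?thesis by simp
qed

lemma ip_mv_unit:
  assumes "A \<in> carrier_mat n n" "s < n" "t < n"
  shows "ip n (mv A (\<lambda>i. if i = t then 1 else 0)) (\<lambda>i. if i = s then 1 else 0) = A $$ (s, t)"
  using assms by (simp add: ip_def mv_def if_distrib cong: if_cong)

lemma vec_l2norm_vec: "vec_l2norm (vec n x) = fnorm n x"
  by (auto simp: vec_l2norm_def fnorm_def intro!: L2_set_cong)

lemma mult_mat_vec_vec:
  assumes "A \<in> carrier_mat n n"
  shows "A *\<^sub>v vec n x = vec n (mv A x)"
  using assms by (intro eq_vecI) (auto simp: mv_def scalar_prod_def atLeast0LessThan intro!: sum.cong)

lemma mat_opnorm_eq_SUP:
  assumes "A \<in> carrier_mat n n"
  shows "mat_opnorm A = (SUP x\<in>{x. fnorm n x \<le> 1}. fnorm n (mv A x))"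
proof -
  have "(\<lambda>x. vec_l2norm (A *\<^sub>v x)) ` {x \<in> carrier_vec n. vec_l2norm x \<le> 1}
      = (\<lambda>x. fnorm n (mv A x)) ` {x. fnorm n x \<le> 1}"
  proof (intro equalityI subsetI)
    fix c assume "c \<in> (\<lambda>x. vec_l2norm (A *\<^sub>v x)) ` {x \<in> carrier_vec n. vec_l2norm x \<le> 1}"
    then obtain x where x: "x \<in> carrier_vec n" "vec_l2norm x \<le> 1" "c = vec_l2norm (A *\<^sub>v x)" by auto
    have "x = vec n (vec_index x)" using x by auto
    with x assms show "c \<in> (\<lambda>x. fnorm n (mv A x)) ` {x. fnorm n x \<le> 1}"
      by (metis (mono_tags, lifting) image_eqI mem_Collect_eq vec_l2norm_vec mult_mat_vec_vec)
  next
    fix c assume "c \<in> (\<lambda>x. fnorm n (mv A x)) ` {x. fnorm n x \<le> 1}"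
    then obtain x where x: "fnorm n x \<le> 1" "c = fnorm n (mv A x)" by auto
    then have "c = vec_l2norm (A *\<^sub>v vec n x)" "vec_l2norm (vec n x) \<le> 1"
      using assms by (simp_all add: vec_l2norm_vec mult_mat_vec_vec)
    then show "c \<in> (\<lambda>x. vec_l2norm (A *\<^sub>v x)) ` {x \<in> carrier_vec n. vec_l2norm x \<le> 1}" by auto
  qed
  then show ?thesis using assms unfolding mat_opnorm_def by auto
qed

lemma fnorm_sq: "(fnorm n x)\<^sup>2 = (\<Sum>s<n. (cmod (x s))\<^sup>2)"
  by (simp add: fnorm_def L2_set_def sum_nonneg)

lemma cmod_le_fnorm: "s < n \<Longrightarrow> cmod (x s) \<le> fnorm n x"
  unfolding fnorm_def by (rule member_le_L2_set) auto

lemma fnorm_zero [simp]: "fnorm n (\<lambda>s. 0) = 0"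
  by (simp add: fnorm_def L2_set_def)

text \<open>A real supremum carries information only for a bounded set. Every coordinate of a vector
  in the unit ball has modulus at most 1, so the sum of the moduli of all entries is a
  bound.\<close>

lemma bdd_above_fnorm_mv:
  assumes "A \<in> carrier_mat n n"
  shows "bdd_above ((\<lambda>x. fnorm n (mv A x)) ` {x. fnorm n x \<le> 1})"
proof -
  have "fnorm n (mv A x) \<le> (\<Sum>s<n. \<Sum>t<n. cmod (A $$ (s, t)))" if "fnorm n x \<le> 1" for x
  proof -
    have "fnorm n (mv A x) \<le> (\<Sum>s<n. cmod (mv A x s))"
      unfolding fnorm_def by (rule L2_set_le_sum) auto
    also have "\<dots> \<le> (\<Sum>s<n. \<Sum>t<n. cmod (A $$ (s, t)))"
    proof (rule sum_mono)
      fix s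
      have "cmod (mv A x s) \<le> (\<Sum>t<n. cmod (A $$ (s, t) * x t))"
        using assms by (auto simp: mv_def intro: norm_sum)
      also have "\<dots> \<le> (\<Sum>t<n. cmod (A $$ (s, t)))"
      proof (rule sum_mono)
        fix t assume "t \<in> {..<n}"
        then have "cmod (x t) \<le> 1" using cmod_le_fnorm[of t n x] that by simp
        then show "cmod (A $$ (s, t) * x t) \<le> cmod (A $$ (s, t))"
          by (simp add: norm_mult mult_left_le)
      qed
      finally show "cmod (mv A x s) \<le> (\<Sum>t<n. cmod (A $$ (s, t)))" .
    qed
    finally show ?thesis .
  qed
  then show ?thesis by (intro bdd_aboveI2) auto
qed

lemma fnorm_eq_0: "fnorm n x = 0 \<longleftrightarrow> (\<forall>s<n. x s = 0)"
  by (auto simp: fnorm_def L2_set_eq_0_iff)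

lemma fnorm_mv_le:
  assumes "A \<in> carrier_mat n n"
  shows "fnorm n (mv A x) \<le> mat_opnorm A * fnorm n x"
proof (cases "fnorm n x = 0")
  case True
  then have "mv A x = mv A (\<lambda>s. 0)"
    using assms by (intro mv_cong) (auto simp: fnorm_eq_0)
  then have "mv A x = (\<lambda>s. 0)" by (simp add: mv_def)
  then show ?thesis using True by simp
next
  case False
  then have pos: "fnorm n x > 0" using fnorm_nonneg[of n x] by linarith
  define c where "c = complex_of_real (1 / fnorm n x)"
  have c: "cmod c = 1 / fnorm n x" using pos by (simp add: c_def norm_divide)
  have "fnorm n (\<lambda>s. c * x s) \<le> 1" using pos by (simp add: fnorm_scale c)
  then have "fnorm n (mv A (\<lambda>s. c * x s)) \<le> mat_opnorm A"
    unfolding mat_opnorm_eq_SUP[OF assms] using bdd_above_fnorm_mv[OF assms]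
    by (intro cSUP_upper) auto
  then show ?thesis using pos by (simp add: mv_scale fnorm_scale c field_simps)
qed

lemma mat_opnorm_nonneg:
  assumes "A \<in> carrier_mat n n" shows "0 \<le> mat_opnorm A"
proof -
  have "fnorm n (mv A (\<lambda>s. 0)) \<le> mat_opnorm A"
    unfolding mat_opnorm_eq_SUP[OF assms] using bdd_above_fnorm_mv[OF assms]
    by (intro cSUP_upper) auto
  then show ?thesis using fnorm_nonneg order_trans by blast
qed

lemma mat_opnorm_leI:
  assumes "A \<in> carrier_mat n n" "0 \<le> c" "\<And>x. fnorm n (mv A x) \<le> c * fnorm n x"
  shows "mat_opnorm A \<le> c"
  unfolding mat_opnorm_eq_SUP[OF assms(1)]
proof (rule cSUP_least)
  show "{x. fnorm n x \<le> 1} \<noteq> {}" by (auto intro!: exI[of _ "\<lambda>s. 0"])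
next
  fix x assume "x \<in> {x. fnorm n x \<le> 1}"
  then show "fnorm n (mv A x) \<le> c" using assms(2) assms(3)[of x] mult_left_le[of "fnorm n x" c]
    by (auto intro: order_trans)
qed

lemma ip_mv_le:
  assumes "A \<in> carrier_mat n n"
  shows "cmod (ip n (mv A x) y) \<le> mat_opnorm A * (fnorm n x * fnorm n y)"
proof -
  have "cmod (ip n (mv A x) y) \<le> fnorm n (mv A x) * fnorm n y" by (rule ip_Cauchy_Schwarz)
  also have "\<dots> \<le> mat_opnorm A * fnorm n x * fnorm n y"
    by (intro mult_right_mono fnorm_mv_le assms fnorm_nonneg)
  finally show ?thesis by (simp add: mult.assoc)
qed

text \<open>Testing with \<open>y = mv A x\<close> yields \<open>fnorm n (mv A x)\<close> squared on
  the left, and one factor cancels. This form suits matrices that are known through sums of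
  sesquilinear forms.\<close>

lemma mat_opnorm_le_ipI:
  assumes "A \<in> carrier_mat n n" "0 \<le> c" "\<And>x y. cmod (ip n (mv A x) y) \<le> c * (fnorm n x * fnorm n y)"
  shows "mat_opnorm A \<le> c"
proof (rule mat_opnorm_leI[OF assms(1,2)])
  fix x
  have "(fnorm n (mv A x))\<^sup>2 \<le> c * (fnorm n x * fnorm n (mv A x))"
    using assms(3)[of x "mv A x"] by (simp add: ip_self norm_power)
  then have "fnorm n (mv A x) * fnorm n (mv A x) \<le> (c * fnorm n x) * fnorm n (mv A x)"
    by (simp add: power2_eq_square mult.assoc)
  then show "fnorm n (mv A x) \<le> c * fnorm n x"
    using assms(2) fnorm_nonneg[of n "mv A x"] fnorm_nonneg[of n x]
    by (cases "fnorm n (mv A x) = 0") (auto simp: mult_le_cancel_right)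
qed

section \<open>Positive semidefinite matrices and quadratic forms\<close>

lemma psd_ip_nonneg:
  assumes "A \<in> carrier_mat n n" "psd A"
  shows "0 \<le> ip n (mv A x) x"
proof -
  have "0 \<le> (A *\<^sub>v vec n x) \<bullet>c vec n x" using assms unfolding psd_def by auto
  also have "(A *\<^sub>v vec n x) \<bullet>c vec n x = ip n (mv A x) x"
    by (auto simp: mult_mat_vec_vec[OF assms(1)] scalar_prod_def ip_def atLeast0LessThan)
  finally show ?thesis .
qed

lemma psdI:
  assumes "A \<in> carrier_mat n n" "\<And>x. 0 \<le> ip n (mv A x) x"
  shows "psd A"
  unfolding psd_def
proof (intro conjI ballI)
  show "square_mat A" using assms by auto
next
  fix x :: "complex vec" assume "x \<in> carrier_vec (dim_row A)"
  then have x: "x = vec n (vec_index x)" using assms(1) by auto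
  have "(A *\<^sub>v vec n (vec_index x)) \<bullet>c vec n (vec_index x) = ip n (mv A (vec_index x)) (vec_index x)"
    by (auto simp: mult_mat_vec_vec[OF assms(1)] scalar_prod_def ip_def atLeast0LessThan)
  then show "0 \<le> (A *\<^sub>v x) \<bullet>c x" using assms(2)[of "vec_index x"] x by simp
qed

text \<open>Polarization without the usual factor 1/4, so that closure of \<open>P\<close> under
  subtraction is enough. It is applied with \<open>P\<close> saying that a number is real and with
  \<open>P\<close> saying that it is 0.\<close>

lemma ip_mv_polarization:
  assumes "\<And>x. P (ip n (mv A x) x)"
    and "\<And>z w :: complex. P z \<Longrightarrow> P w \<Longrightarrow> P (z - w)"
  shows "P (ip n (mv A x) y + ip n (mv A y) x)" "P (\<i> * (ip n (mv A y) x - ip n (mv A x) y))"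
proof -
  have 1: "ip n (mv A x) y + ip n (mv A y) x
    = ip n (mv A (\<lambda>s. x s + y s)) (\<lambda>s. x s + y s) - ip n (mv A x) x - ip n (mv A y) y"
    by (simp add: mv_add ip_add_left ip_add_right)
  have 2: "\<i> * (ip n (mv A y) x - ip n (mv A x) y)
    = ip n (mv A (\<lambda>s. x s + \<i> * y s)) (\<lambda>s. x s + \<i> * y s) - ip n (mv A x) x - ip n (mv A y) y"
    by (simp add: mv_add ip_add_left ip_add_right mv_scale ip_scale_left ip_scale_right algebra_simps)
  show "P (ip n (mv A x) y + ip n (mv A y) x)" unfolding 1 by (intro assms)
  show "P (\<i> * (ip n (mv A y) x - ip n (mv A x) y))" unfolding 2 by (intro assms)
qed

text \<open>The quadratic form is real, so by polarization both the sum of the two mixed terms and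
  \<open>\<i>\<close> times their difference are real: opposite imaginary parts, equal real
  parts.\<close>

lemma psd_hermitian:
  assumes "A \<in> carrier_mat n n" "psd A"
  shows "ip n (mv A y) x = cnj (ip n (mv A x) y)"
proof -
  have "Im (ip n (mv A x) x) = 0" for x
    using psd_ip_nonneg[OF assms, of x] by (simp add: less_eq_complex_def)
  note p = ip_mv_polarization[where P = "\<lambda>z. Im z = 0", OF this]
  show ?thesis using p(1)[of x y] p(2)[of y x] by (simp add: complex_eq_iff)
qed

text \<open>Over the complex numbers the quadratic form determines the matrix. The hypothesis speaks
  of unit vectors because these are the vectors that define rank-one projections.\<close>

lemma zero_mat_if_quadratic_form_zero:
  assumes A: "A \<in> carrier_mat n n" and 0: "\<And>u. fnorm n u = 1 \<Longrightarrow> ip n (mv A u) u = 0"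
  shows "A = 0\<^sub>m n n"
proof -
  have q: "ip n (mv A x) x = 0" for x
  proof (cases "fnorm n x = 0")
    case True
    then have "cmod (ip n (mv A x) x) \<le> 0" using ip_Cauchy_Schwarz[of n "mv A x" x] by simp
    then show ?thesis by simp
  next
    case False
    define c where "c = complex_of_real (1 / fnorm n x)"
    have c: "cmod c * fnorm n x = 1" "c \<noteq> 0" using False fnorm_nonneg[of n x]
      by (auto simp: c_def norm_divide)
    have "ip n (mv A (\<lambda>s. c * x s)) (\<lambda>s. c * x s) = 0"
      by (rule 0) (simp add: fnorm_scale c)
    then show ?thesis using c(2) by (simp add: mv_scale ip_scale_left ip_scale_right)
  qed
  have z: "ip n (mv A x) y = 0" for x y
    using ip_mv_polarization[where P = "\<lambda>z. z = 0", of n A x y] q by auto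
  show ?thesis
    using A z ip_mv_unit[OF A] by (intro eq_matI) auto
qed

lemma psd_opnorm_le:
  assumes A: "A \<in> carrier_mat n n" "psd A" and "0 \<le> c"
    and le: "\<And>x. Re (ip n (mv A x) x) \<le> c * (fnorm n x)\<^sup>2"
  shows "mat_opnorm A \<le> c"
  \<comment> \<open>for \<open>b > c\<close>, expand \<open>0 \<le> \<langle>A z, z\<rangle>\<close> at \<open>z = x - A x / b\<close>\<close>
proof (rule field_le_epsilon)
  fix e :: real assume "0 < e"
  \<comment> \<open>\<open>c\<close> may be 0, so the division takes place at a strictly larger
    bound.\<close>
  define b where "b = c + e"
  have b: "b > 0" using \<open>0 < e\<close> \<open>0 \<le> c\<close> by (simp add: b_def)
  have leb: "Re (ip n (mv A x) x) \<le> b * (fnorm n x)\<^sup>2" for x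
  proof -
    have "c * (fnorm n x)\<^sup>2 \<le> b * (fnorm n x)\<^sup>2"
      using \<open>0 < e\<close> by (intro mult_right_mono) (auto simp: b_def)
    with le[of x] show ?thesis by linarith
  qed
  have "fnorm n (mv A x) \<le> b * fnorm n x" for x
  proof -
    let ?y = "mv A x"
    define a where "a = complex_of_real (1 / b)"
    have cnj_a: "cnj a = a" by (simp add: a_def)
    have "0 \<le> Re (ip n (mv A (\<lambda>s. x s - a * ?y s)) (\<lambda>s. x s - a * ?y s))"
      using psd_ip_nonneg[OF A] by (simp add: less_eq_complex_def)
    also have "ip n (mv A (\<lambda>s. x s - a * ?y s)) (\<lambda>s. x s - a * ?y s)
        = ip n ?y x - a * ip n ?y ?y - a * ip n (mv A ?y) x + a * a * ip n (mv A ?y) ?y"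
      by (simp add: mv_diff ip_diff_left ip_diff_right mv_scale ip_scale_left ip_scale_right cnj_a
          algebra_simps)
    also have "ip n (mv A ?y) x = ip n ?y ?y"
      using psd_hermitian[OF A, of ?y x] by (simp add: ip_self)
    also have "Re (ip n ?y x - a * ip n ?y ?y - a * ip n ?y ?y + a * a * ip n (mv A ?y) ?y)
       = Re (ip n ?y x) - 2 / b * (fnorm n ?y)\<^sup>2 + 1 / b\<^sup>2 * Re (ip n (mv A ?y) ?y)"
      by (simp add: ip_self a_def power2_eq_square)
    \<comment> \<open>The bound on the quadratic form enters twice: at \<open>x\<close> and at
      \<open>mv A x\<close>.\<close>
    also have "\<dots> \<le> b * (fnorm n x)\<^sup>2 - 2 / b * (fnorm n ?y)\<^sup>2 + 1 / b\<^sup>2 * (b * (fnorm n ?y)\<^sup>2)"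
      by (intro add_mono diff_mono mult_left_mono leb) (auto simp: less_imp_le[OF b])
    also have "\<dots> = b * (fnorm n x)\<^sup>2 - 1 / b * (fnorm n ?y)\<^sup>2"
      using b by (simp add: field_simps power2_eq_square)
    finally have "(fnorm n ?y)\<^sup>2 \<le> (b * fnorm n x)\<^sup>2"
      using b by (simp add: field_simps power2_eq_square)
    then show ?thesis by (rule power2_le_imp_le) (simp add: less_imp_le[OF b])
  qed
  then have "mat_opnorm A \<le> b" using b by (intro mat_opnorm_leI[OF A(1)] less_imp_le[OF b])
  then show "mat_opnorm A \<le> c + e" by (simp add: b_def)
qed

text \<open>Sum the nonnegative values of the form at \<open>f b - f c\<close> over all pairs. The
  diagonal terms add up to \<open>2 R\<close> times the sum on the right, the mixed terms to twice
  the value at the sum of the vectors.\<close>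

lemma psd_ip_sum_le:
  assumes A: "A \<in> carrier_mat n n" "psd A"
  shows "Re (ip n (mv A (\<lambda>s. \<Sum>b<R. f b s)) (\<lambda>s. \<Sum>b<R. f b s)) \<le> real R * (\<Sum>b<R. Re (ip n (mv A (f b)) (f b)))"
proof -
  let ?q = "\<lambda>x y. ip n (mv A x) y"
  have "0 \<le> (\<Sum>b<R. \<Sum>c<R. Re (?q (\<lambda>s. f b s - f c s) (\<lambda>s. f b s - f c s)))"
    using psd_ip_nonneg[OF A] by (intro sum_nonneg) (simp add: less_eq_complex_def)
  also have "\<dots> = (\<Sum>b<R. \<Sum>c<R. Re (?q (f b) (f b)) + Re (?q (f c) (f c)) - Re (?q (f b) (f c)) - Re (?q (f c) (f b)))"
    by (simp add: mv_diff ip_diff_left ip_diff_right algebra_simps)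
  also have "\<dots> = 2 * (R * (\<Sum>b<R. Re (?q (f b) (f b)))) - 2 * (\<Sum>b<R. \<Sum>c<R. Re (?q (f b) (f c)))"
  proof -
    have "(\<Sum>b<R. \<Sum>c<R. Re (?q (f c) (f b))) = (\<Sum>b<R. \<Sum>c<R. Re (?q (f b) (f c)))" by (rule sum.swap)
    then show ?thesis by (simp add: sum.distrib sum_subtractf flip: sum_distrib_left)
  qed
  also have "(\<Sum>b<R. \<Sum>c<R. Re (?q (f b) (f c))) = Re (?q (\<lambda>s. \<Sum>b<R. f b s) (\<lambda>s. \<Sum>b<R. f b s))"
    by (simp add: mv_sum ip_sum_left ip_sum_right)
  finally show ?thesis by linarith
qed

lemma ip_mv_adjoint_mult:
  assumes "A \<in> carrier_mat n n"
  shows "ip n (mv (mat_adjoint A * A) x) x = of_real ((fnorm n (mv A x))\<^sup>2)"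
proof -
  have "ip n (mv (mat_adjoint A * A) x) x = ip n (mv (mat_adjoint A) (mv A x)) x"
    using assms by (intro ip_cong mv_mult[where n=n and m=n and p=n]) auto
  also have "\<dots> = cnj (ip n (mv A x) (mv A x))"
    using ip_mv_adjoint[OF assms, of x "mv A x"] ip_cnj by metis
  finally show ?thesis by (simp add: ip_self)
qed

lemma psd_adjoint_mult: "A \<in> carrier_mat n n \<Longrightarrow> psd (mat_adjoint A * A)"
proof (rule psdI[where n=n])
  fix x assume A: "A \<in> carrier_mat n n"
  show "0 \<le> ip n (mv (mat_adjoint A * A) x) x"
    unfolding ip_mv_adjoint_mult[OF A] by (simp add: less_eq_complex_def del: of_real_power)
qed (rule mult_carrier_mat, auto)

text \<open>One half of the C*-identity, from \<open>ip_mv_adjoint_mult\<close>; it carries the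
  bound for positive elements over to all of the algebra.\<close>

lemma opnorm_sq_le:
  assumes A: "A \<in> carrier_mat n n"
  shows "(mat_opnorm A)\<^sup>2 \<le> mat_opnorm (mat_adjoint A * A)"
proof -
  let ?c = "mat_opnorm (mat_adjoint A * A)"
  have C: "mat_adjoint A * A \<in> carrier_mat n n" using A by (intro mult_carrier_mat) auto
  have "fnorm n (mv A x) \<le> sqrt ?c * fnorm n x" for x
  proof -
    have "(fnorm n (mv A x))\<^sup>2 = cmod (ip n (mv (mat_adjoint A * A) x) x)"
      by (simp add: ip_mv_adjoint_mult[OF A] norm_power)
    also have "\<dots> \<le> ?c * (fnorm n x * fnorm n x)" by (rule ip_mv_le[OF C])
    also have "\<dots> = (sqrt ?c * fnorm n x)\<^sup>2"
      using mat_opnorm_nonneg[OF C] by (simp add: power_mult_distrib power2_eq_square)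
    finally show ?thesis
      by (rule power2_le_imp_le) (simp add: mat_opnorm_nonneg[OF C])
  qed
  then have "mat_opnorm A \<le> sqrt ?c" using mat_opnorm_nonneg[OF C] by (intro mat_opnorm_leI[OF A]) auto
  then have "(mat_opnorm A)\<^sup>2 \<le> (sqrt ?c)\<^sup>2"
    using mat_opnorm_nonneg[OF A] by (intro power_mono)
  then show ?thesis using mat_opnorm_nonneg[OF C] by simp
qed

subsection \<open>Block averages\<close>

text \<open>Coordinate \<open>s < d\<close> is coordinate number \<open>off s\<close> of the diagonal block \<open>blk s < R\<close>; blocks of
  the same type \<open>ty\<close> carry the same matrix in \<open>alg\<close>, of size \<open>sz\<close>.\<close>

locale block_index =
  fixes d R :: nat and blk off ty sz :: "nat \<Rightarrow> nat"
  assumes bij: "bij_betw (\<lambda>s. (blk s, off s)) {..<d} (SIGMA b:{..<R}. {..<sz (ty b)})"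
begin

definition ix :: "nat \<Rightarrow> nat \<Rightarrow> nat" where
  "ix b a = inv_into {..<d} (\<lambda>s. (blk s, off s)) (b, a)"

definition cls :: "nat \<Rightarrow> nat set" where
  "cls b = {b'. b' < R \<and> ty b' = ty b}"

definition alg :: "complex mat set" where
  "alg = {A \<in> carrier_mat d d. \<exists>F. \<forall>s<d. \<forall>t<d.
     A $$ (s, t) = (if blk s = blk t then F (ty (blk s)) (off s) (off t) else 0)}"

definition avg :: "complex mat \<Rightarrow> complex mat" where
  "avg X = mat d d (\<lambda>(s, t). if blk s = blk t
     then (\<Sum>b\<in>cls (blk s). X $$ (ix b (off s), ix b (off t))) / of_nat (card (cls (blk s))) else 0)"

text \<open>For \<open>b'\<close> of the same type as \<open>b\<close>, a partial isometry applied
  to \<open>x\<close>: it moves the component of \<open>x\<close> in block \<open>b\<close> to the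
  position of block \<open>b'\<close>. The block \<open>b'\<close> of a matrix, tested against block
  \<open>b\<close> of \<open>x\<close>, thus becomes a form of the whole matrix.\<close>

definition shift :: "nat \<Rightarrow> nat \<Rightarrow> (nat \<Rightarrow> complex) \<Rightarrow> nat \<Rightarrow> complex" where
  "shift b b' x = (\<lambda>s. if blk s = b' then x (ix b (off s)) else 0)"

lemma ix_blk_off [simp]: "s < d \<Longrightarrow> ix (blk s) (off s) = s"
  unfolding ix_def using bij_betw_inv_into_left[OF bij, of s] by simp

lemma blk_less [simp]: "s < d \<Longrightarrow> blk s < R"
  and off_less [simp]: "s < d \<Longrightarrow> off s < sz (ty (blk s))"
  using bij_betwE[OF bij] by auto

lemma ix:
  assumes "b < R" "a < sz (ty b)"
  shows ix_less [simp]: "ix b a < d" and blk_ix [simp]: "blk (ix b a) = b" and off_ix [simp]: "off (ix b a) = a"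
proof -
  have "(b, a) \<in> (SIGMA b:{..<R}. {..<sz (ty b)})" using assms by auto
  then have "ix b a \<in> {..<d}" "(blk (ix b a), off (ix b a)) = (b, a)"
    unfolding ix_def using bij_betw_inv_into_right[OF bij, of "(b, a)"] bij_betw_apply[OF bij_betw_inv_into[OF bij], of "(b, a)"]
    by auto
  then show "ix b a < d" "blk (ix b a) = b" "off (ix b a) = a" by auto
qed

lemma sum_index:
  fixes f :: "nat \<Rightarrow> 'a :: comm_monoid_add"
  shows "(\<Sum>s<d. f s) = (\<Sum>b<R. \<Sum>a<sz (ty b). f (ix b a))"
proof -
  have "(\<Sum>s<d. f s) = (\<Sum>s<d. (\<lambda>(b, a). f (ix b a)) (blk s, off s))" by simp
  also have "\<dots> = (\<Sum>(b, a)\<in>(SIGMA b:{..<R}. {..<sz (ty b)}). f (ix b a))"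
    by (rule sum.reindex_bij_betw[OF bij])
  also have "\<dots> = (\<Sum>b<R. \<Sum>a<sz (ty b). f (ix b a))"
    by (subst sum.Sigma) auto
  finally show ?thesis .
qed

lemma sum_block:
  fixes f :: "nat \<Rightarrow> 'a :: comm_monoid_add"
  assumes "b < R"
  shows "(\<Sum>s<d. if blk s = b then f s else 0) = (\<Sum>a<sz (ty b). f (ix b a))"
proof -
  have "(\<Sum>s<d. if blk s = b then f s else 0) = (\<Sum>c<R. \<Sum>a<sz (ty c). if c = b then f (ix c a) else 0)"
    by (auto simp: sum_index intro!: sum.cong)
  also have "\<dots> = (\<Sum>c<R. if c = b then \<Sum>a<sz (ty c). f (ix c a) else 0)"
    by (intro sum.cong) auto
  also have "\<dots> = (\<Sum>a<sz (ty b). f (ix b a))" using assms by simp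
  finally show ?thesis .
qed

lemma finite_cls [simp]: "finite (cls b)"
  by (simp add: cls_def)

lemma self_in_cls: "b < R \<Longrightarrow> b \<in> cls b"
  by (simp add: cls_def)

lemma card_cls_pos: "b < R \<Longrightarrow> 0 < card (cls b)"
  using self_in_cls card_gt_0_iff finite_cls by blast

lemma ix_off_less [simp]:
  assumes "s < d" "b \<in> cls (blk s)" shows "ix b (off s) < d"
  using assms off_less[of s] by (intro ix_less) (auto simp: cls_def simp del: off_less)

lemma alg_carrier: "A \<in> alg \<Longrightarrow> A \<in> carrier_mat d d"
  by (simp add: alg_def)

lemma algI:
  assumes "A \<in> carrier_mat d d"
    and "\<And>s t. s < d \<Longrightarrow> t < d \<Longrightarrow> A $$ (s, t) = (if blk s = blk t then F (ty (blk s)) (off s) (off t) else 0)"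
  shows "A \<in> alg"
  using assms unfolding alg_def by blast

lemma avg_carrier [simp]: "avg X \<in> carrier_mat d d"
  by (simp add: avg_def)

lemma avg_in_alg: "avg X \<in> alg"
proof (rule algI[where F = "\<lambda>i a c. (\<Sum>b\<in>{b. b < R \<and> ty b = i}. X $$ (ix b a, ix b c)) / of_nat (card {b. b < R \<and> ty b = i})"])
qed (auto simp: avg_def cls_def)

lemma avg_add:
  assumes "X \<in> carrier_mat d d" "Y \<in> carrier_mat d d"
  shows "avg (X + Y) = avg X + avg Y"
proof (rule eq_matI)
  fix s t assume "s < dim_row (avg X + avg Y)" "t < dim_col (avg X + avg Y)"
  then have st: "s < d" "t < d" by (auto simp: avg_def)
  have "(X + Y) $$ (ix b (off s), ix b (off t)) = X $$ (ix b (off s), ix b (off t)) + Y $$ (ix b (off s), ix b (off t))"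
    if "blk s = blk t" "b \<in> cls (blk s)" for b
    using assms st that by simp
  then show "avg (X + Y) $$ (s, t) = (avg X + avg Y) $$ (s, t)"
    using st by (simp add: avg_def sum.distrib add_divide_distrib)
qed (auto simp: avg_def)

lemma avg_smult:
  assumes "X \<in> carrier_mat d d"
  shows "avg (c \<cdot>\<^sub>m X) = c \<cdot>\<^sub>m avg X"
proof (rule eq_matI)
  fix s t assume "s < dim_row (c \<cdot>\<^sub>m avg X)" "t < dim_col (c \<cdot>\<^sub>m avg X)"
  then have st: "s < d" "t < d" by (auto simp: avg_def)
  have "(c \<cdot>\<^sub>m X) $$ (ix b (off s), ix b (off t)) = c * X $$ (ix b (off s), ix b (off t))"
    if "blk s = blk t" "b \<in> cls (blk s)" for b
    using assms st that by simp
  then show "avg (c \<cdot>\<^sub>m X) $$ (s, t) = (c \<cdot>\<^sub>m avg X) $$ (s, t)"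
    using st by (simp add: avg_def flip: sum_distrib_left)
qed (auto simp: avg_def)

lemma avg_alg:
  assumes "X \<in> alg" shows "avg X = X"
proof (rule eq_matI)
  obtain F where X: "X \<in> carrier_mat d d" and F: "\<And>s t. s < d \<Longrightarrow> t < d \<Longrightarrow>
     X $$ (s, t) = (if blk s = blk t then F (ty (blk s)) (off s) (off t) else 0)"
    using assms unfolding alg_def by blast
  fix s t assume "s < dim_row X" "t < dim_col X"
  then have st: "s < d" "t < d" using X by auto
  show "avg X $$ (s, t) = X $$ (s, t)"
  proof (cases "blk s = blk t")
    case True
    have "X $$ (ix b (off s), ix b (off t)) = F (ty (blk s)) (off s) (off t)" if "b \<in> cls (blk s)" for b
    proof -
      have "b < R" "ty b = ty (blk s)" "off s < sz (ty b)" "off t < sz (ty b)"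
        using that st True off_less[of t] off_less[of s] by (auto simp: cls_def simp del: off_less)
      then show ?thesis by (simp add: F)
    qed
    then show ?thesis using st True self_in_cls[of "blk s"] by (auto simp: avg_def F[OF st])
  next
    case False
    then show ?thesis using st by (simp add: avg_def F)
  qed
qed (use assms in \<open>auto simp: alg_def avg_def\<close>)

section \<open>Norm estimates and trace for the block average\<close>

lemma ip_shift:
  assumes X: "X \<in> carrier_mat d d" and b: "b < R" "b' \<in> cls b"
  shows "ip d (mv X (shift b b' x)) (shift b b' y)
    = (\<Sum>a<sz (ty b). \<Sum>c<sz (ty b). X $$ (ix b' a, ix b' c) * x (ix b c) * cnj (y (ix b a)))"
proof -
  have b': "b' < R" "ty b' = ty b" using b by (auto simp: cls_def)
  have mv: "mv X (shift b b' x) s = (\<Sum>c<sz (ty b). X $$ (s, ix b' c) * x (ix b c))" for s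
  proof -
    have "mv X (shift b b' x) s = (\<Sum>t<d. if blk t = b' then X $$ (s, t) * x (ix b (off t)) else 0)"
      using X by (auto simp: mv_def shift_def intro!: sum.cong)
    also have "\<dots> = (\<Sum>c<sz (ty b). X $$ (s, ix b' c) * x (ix b c))"
      using b' by (simp add: sum_block)
    finally show ?thesis .
  qed
  have "ip d (mv X (shift b b' x)) (shift b b' y)
      = (\<Sum>s<d. if blk s = b' then mv X (shift b b' x) s * cnj (y (ix b (off s))) else 0)"
    by (auto simp: ip_def shift_def intro!: sum.cong)
  also have "\<dots> = (\<Sum>a<sz (ty b). mv X (shift b b' x) (ix b' a) * cnj (y (ix b a)))"
    using b' by (simp add: sum_block)
  finally show ?thesis by (simp add: mv sum_distrib_right)
qed

text \<open>The average as a sum of compressions of \<open>X\<close> by the partial isometries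
  \<open>shift b b'\<close>. Contractivity and the lower bound for positive \<open>X\<close> are
  both read off from this formula.\<close>

lemma ip_avg:
  assumes X: "X \<in> carrier_mat d d"
  shows "ip d (mv (avg X) x) y
    = (\<Sum>b<R. (\<Sum>b'\<in>cls b. ip d (mv X (shift b b' x)) (shift b b' y)) / of_nat (card (cls b)))"
proof -
  have mv: "mv (avg X) x (ix b a) = (\<Sum>c<sz (ty b).
      (\<Sum>b'\<in>cls b. X $$ (ix b' a, ix b' c)) / of_nat (card (cls b)) * x (ix b c))"
    if "b < R" "a < sz (ty b)" for b a
  proof -
    have "mv (avg X) x (ix b a) = (\<Sum>t<d. if blk t = b then
        (\<Sum>b'\<in>cls b. X $$ (ix b' a, ix b' (off t))) / of_nat (card (cls b)) * x t else 0)"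
      using that by (auto simp: mv_def avg_def intro!: sum.cong)
    also have "\<dots> = (\<Sum>c<sz (ty b).
      (\<Sum>b'\<in>cls b. X $$ (ix b' a, ix b' c)) / of_nat (card (cls b)) * x (ix b c))"
      using that by (simp add: sum_block)
    finally show ?thesis .
  qed
  have "ip d (mv (avg X) x) y = (\<Sum>b<R. \<Sum>a<sz (ty b). mv (avg X) x (ix b a) * cnj (y (ix b a)))"
    by (simp add: ip_def sum_index)
  also have "\<dots> = (\<Sum>b<R. \<Sum>a<sz (ty b). \<Sum>c<sz (ty b). \<Sum>b'\<in>cls b.
      X $$ (ix b' a, ix b' c) * x (ix b c) * cnj (y (ix b a)) / of_nat (card (cls b)))"
    by (intro sum.cong refl) (simp add: mv sum_distrib_right sum_divide_distrib sum_distrib_left algebra_simps)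
  also have "\<dots> = (\<Sum>b<R. \<Sum>b'\<in>cls b. \<Sum>a<sz (ty b). \<Sum>c<sz (ty b).
      X $$ (ix b' a, ix b' c) * x (ix b c) * cnj (y (ix b a)) / of_nat (card (cls b)))"
    by (subst sum.swap[of _ "cls _"], subst sum.swap[of _ "cls _"]) simp
  also have "\<dots> = (\<Sum>b<R. (\<Sum>b'\<in>cls b. ip d (mv X (shift b b' x)) (shift b b' y)) / of_nat (card (cls b)))"
    using X by (simp add: ip_shift sum_divide_distrib)
  finally show ?thesis .
qed

definition bnorm :: "nat \<Rightarrow> (nat \<Rightarrow> complex) \<Rightarrow> real" where
  "bnorm b x = L2_set (\<lambda>a. cmod (x (ix b a))) {..<sz (ty b)}"

lemma bnorm_sq: "(bnorm b x)\<^sup>2 = (\<Sum>a<sz (ty b). (cmod (x (ix b a)))\<^sup>2)"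
  by (simp add: bnorm_def L2_set_def sum_nonneg)

lemma bnorm_nonneg: "0 \<le> bnorm b x"
  by (simp add: bnorm_def)

lemma fnorm_shift:
  assumes "b' < R" "ty b' = ty b"
  shows "fnorm d (shift b b' x) = bnorm b x"
proof -
  have "(fnorm d (shift b b' x))\<^sup>2 = (\<Sum>s<d. if blk s = b' then (cmod (x (ix b (off s))))\<^sup>2 else 0)"
    by (auto simp: fnorm_sq shift_def intro!: sum.cong)
  also have "\<dots> = (bnorm b x)\<^sup>2" using assms by (simp add: sum_block bnorm_sq)
  finally show ?thesis by (simp add: bnorm_nonneg)
qed

lemma fnorm_eq_bnorm: "fnorm d x = L2_set (\<lambda>b. bnorm b x) {..<R}"
proof -
  have "(fnorm d x)\<^sup>2 = (\<Sum>b<R. (bnorm b x)\<^sup>2)"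
    by (simp add: fnorm_sq bnorm_sq sum_index)
  then show ?thesis unfolding L2_set_def by (metis fnorm_nonneg real_sqrt_unique)
qed

text \<open>\<open>shift b b'\<close> preserves the norm of the component in block \<open>b\<close>,
  so every term of \<open>ip_avg\<close>, and hence every mean over a class, is at most
  \<open>mat_opnorm X * (bnorm b x * bnorm b y)\<close>. Cauchy-Schwarz over the blocks does the
  rest.\<close>

lemma avg_opnorm_le:
  assumes X: "X \<in> carrier_mat d d"
  shows "mat_opnorm (avg X) \<le> mat_opnorm X"
proof (rule mat_opnorm_le_ipI[OF avg_carrier mat_opnorm_nonneg[OF X]])
  fix x y
  have "cmod (ip d (mv (avg X) x) y) \<le> (\<Sum>b<R. mat_opnorm X * (bnorm b x * bnorm b y))"
    unfolding ip_avg[OF X]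
  proof (rule sum_norm_le)
    fix b assume "b \<in> {..<R}"
    then have b: "b < R" by simp
    let ?S = "\<Sum>b'\<in>cls b. ip d (mv X (shift b b' x)) (shift b b' y)"
    have "cmod ?S \<le> (\<Sum>b'\<in>cls b. mat_opnorm X * (bnorm b x * bnorm b y))"
    proof (rule sum_norm_le)
      fix b' assume "b' \<in> cls b"
      then show "cmod (ip d (mv X (shift b b' x)) (shift b b' y)) \<le> mat_opnorm X * (bnorm b x * bnorm b y)"
        using ip_mv_le[OF X, of "shift b b' x" "shift b b' y"] by (simp add: fnorm_shift cls_def)
    qed
    then have "cmod ?S \<le> card (cls b) * (mat_opnorm X * (bnorm b x * bnorm b y))" by simp
    then show "cmod (?S / of_nat (card (cls b))) \<le> mat_opnorm X * (bnorm b x * bnorm b y)"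
      using card_cls_pos[OF b] by (simp add: norm_divide divide_le_eq mult.commute)
  qed
  also have "\<dots> = mat_opnorm X * (\<Sum>b<R. \<bar>bnorm b x\<bar> * \<bar>bnorm b y\<bar>)"
    by (simp add: sum_distrib_left bnorm_nonneg)
  also have "\<dots> \<le> mat_opnorm X * (fnorm d x * fnorm d y)"
    unfolding fnorm_eq_bnorm by (intro mult_left_mono L2_set_mult_ineq mat_opnorm_nonneg[OF X])
  finally show "cmod (ip d (mv (avg X) x) y) \<le> mat_opnorm X * (fnorm d x * fnorm d y)" .
qed

lemma sum_shift:
  assumes "s < d" shows "(\<Sum>b<R. shift b b x s) = x s"
  using assms by (simp add: shift_def)

text \<open>Cutting \<open>x\<close> into its block components \<open>shift b b x\<close> costs a factor \<open>R\<close>, and keeping only the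
  term \<open>b' = b\<close> of the average costs a factor \<open>M\<close>.\<close>

lemma psd_opnorm_le_avg:
  assumes X: "X \<in> carrier_mat d d" "psd X" and M: "\<And>b. b < R \<Longrightarrow> card (cls b) \<le> M"
  shows "mat_opnorm X \<le> real R * real M * mat_opnorm (avg X)"
proof (rule psd_opnorm_le[OF X])
  show "0 \<le> real R * real M * mat_opnorm (avg X)" by (simp add: mat_opnorm_nonneg[OF avg_carrier])
next
  fix x
  let ?q = "\<lambda>b b'. Re (ip d (mv X (shift b b' x)) (shift b b' x))"
  have q: "0 \<le> ?q b b'" for b b' using psd_ip_nonneg[OF X] by (simp add: less_eq_complex_def)
  have "Re (ip d (mv X x) x) = Re (ip d (mv X (\<lambda>s. \<Sum>b<R. shift b b x s)) (\<lambda>s. \<Sum>b<R. shift b b x s))"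
    using X by (intro arg_cong[of _ _ Re] ip_cong fun_cong[OF mv_cong]) (auto simp: sum_shift)
  also have "\<dots> \<le> R * (\<Sum>b<R. ?q b b)" by (rule psd_ip_sum_le[OF X])
  also have "\<dots> \<le> R * (\<Sum>b<R. M * ((\<Sum>b'\<in>cls b. ?q b b') / card (cls b)))"
  proof (intro mult_left_mono sum_mono)
    fix b assume "b \<in> {..<R}"
    then have b: "b < R" by simp
    \<comment> \<open>The terms added on the right are nonnegative because \<open>X\<close> is
      positive.\<close>
    have "?q b b \<le> (\<Sum>b'\<in>cls b. ?q b b')"
      using self_in_cls[OF b] q by (intro member_le_sum) auto
    also have "\<dots> \<le> real M * ((\<Sum>b'\<in>cls b. ?q b b') / card (cls b))"
    proof -
      have "card (cls b) * (\<Sum>b'\<in>cls b. ?q b b') \<le> M * (\<Sum>b'\<in>cls b. ?q b b')"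
        using M[OF b] q by (intro mult_right_mono sum_nonneg) auto
      then show ?thesis using card_cls_pos[OF b] by (simp add: field_simps)
    qed
    finally show "?q b b \<le> real M * ((\<Sum>b'\<in>cls b. ?q b b') / card (cls b))" .
  qed auto
  also have "\<dots> = R * M * Re (ip d (mv (avg X) x) x)"
    by (simp add: ip_avg[OF X(1)] sum_distrib_left mult.assoc)
  also have "\<dots> \<le> R * M * (mat_opnorm (avg X) * (fnorm d x * fnorm d x))"
    using order_trans[OF complex_Re_le_cmod ip_mv_le[OF avg_carrier]] by (intro mult_left_mono) auto
  finally show "Re (ip d (mv X x) x) \<le> real R * real M * mat_opnorm (avg X) * (fnorm d x)\<^sup>2"
    by (simp add: power2_eq_square mult.assoc)
qed

text \<open>Double counting: the trace of block \<open>b'\<close> of \<open>X\<close> occurs once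
  for each member \<open>b\<close> of its class, each time divided by the size of the class.\<close>

lemma trace_avg:
  assumes X: "X \<in> carrier_mat d d"
  shows "mat_trace (avg X) = mat_trace X"
proof -
  define g where "g b = (\<Sum>a<sz (ty b). X $$ (ix b a, ix b a))" for b
  have "mat_trace (avg X) = (\<Sum>b<R. \<Sum>a<sz (ty b). avg X $$ (ix b a, ix b a))"
    by (simp add: mat_trace_def sum_index avg_def)
  also have "\<dots> = (\<Sum>b<R. (\<Sum>a<sz (ty b). \<Sum>b'\<in>cls b. X $$ (ix b' a, ix b' a)) / of_nat (card (cls b)))"
    by (auto simp: avg_def sum_divide_distrib intro!: sum.cong)
  also have "\<dots> = (\<Sum>b<R. (\<Sum>b'\<in>cls b. g b') / of_nat (card (cls b)))"
    by (subst sum.swap) (auto simp: g_def cls_def intro!: sum.cong arg_cong2[of _ _ _ _ "(/)"])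
  \<comment> \<open>The denominator moves from the class of \<open>b\<close> to the equal class of
    \<open>b'\<close>, so that after the interchange of sums the summand does not depend on
    \<open>b\<close>.\<close>
  also have "\<dots> = (\<Sum>b<R. \<Sum>b'<R. if ty b' = ty b then g b' / of_nat (card (cls b')) else 0)"
  proof (rule sum.cong)
    fix b assume "b \<in> {..<R}"
    have "(\<Sum>b'\<in>cls b. g b') / of_nat (card (cls b)) = (\<Sum>b'\<in>cls b. g b' / of_nat (card (cls b')))"
      unfolding sum_divide_distrib by (rule sum.cong) (auto simp: cls_def)
    also have "\<dots> = (\<Sum>b'\<in>{b'\<in>{..<R}. ty b' = ty b}. g b' / of_nat (card (cls b')))"
      by (rule sum.cong) (auto simp: cls_def)
    finally show "(\<Sum>b'\<in>cls b. g b') / of_nat (card (cls b))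
        = (\<Sum>b'<R. if ty b' = ty b then g b' / of_nat (card (cls b')) else 0)"
      by (simp only: sum.inter_filter finite_lessThan)
  qed simp
  also have "\<dots> = (\<Sum>b'<R. \<Sum>b<R. if ty b' = ty b then g b' / of_nat (card (cls b')) else 0)"
    by (rule sum.swap)
  also have "\<dots> = (\<Sum>b'<R. g b')"
  proof (rule sum.cong)
    fix b' assume b': "b' \<in> {..<R}"
    have "(\<Sum>b<R. if ty b' = ty b then g b' / of_nat (card (cls b')) else 0)
        = (\<Sum>b\<in>{b\<in>{..<R}. ty b' = ty b}. g b' / of_nat (card (cls b')))"
      by (simp only: sum.inter_filter finite_lessThan)
    also have "{b\<in>{..<R}. ty b' = ty b} = cls b'" by (auto simp: cls_def)
    finally show "(\<Sum>b<R. if ty b' = ty b then g b' / of_nat (card (cls b')) else 0) = g b'"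
      using b' self_in_cls[of b'] by auto
  qed simp
  also have "\<dots> = mat_trace X" using X by (simp add: g_def mat_trace_def sum_index)
  finally show ?thesis .
qed

section \<open>Projections of the block algebra and separation\<close>

lemma zero_in_alg: "0\<^sub>m d d \<in> alg"
  by (rule algI[where F = "\<lambda>_ _ _. 0"]) auto

lemma one_in_alg: "1\<^sub>m d \<in> alg"
proof (rule algI[where F = "\<lambda>_ a c. if a = c then 1 else 0"])
  fix s t assume st: "s < d" "t < d"
  have "s = t" if "blk s = blk t" "off s = off t" using st that ix_blk_off by metis
  then show "1\<^sub>m d $$ (s, t) = (if blk s = blk t then if off s = off t then 1 else 0 else 0)"
    using st by auto
qed auto

lemma diff_in_alg:
  assumes "A \<in> alg" "A' \<in> alg" shows "A - A' \<in> alg"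
proof -
  obtain F where F: "\<forall>s<d. \<forall>t<d. A $$ (s, t) = (if blk s = blk t then F (ty (blk s)) (off s) (off t) else 0)"
    using assms unfolding alg_def by blast
  obtain F' where F': "\<forall>s<d. \<forall>t<d. A' $$ (s, t) = (if blk s = blk t then F' (ty (blk s)) (off s) (off t) else 0)"
    using assms unfolding alg_def by blast
  show ?thesis
    using assms[THEN alg_carrier] F F' by (intro algI[where F = "\<lambda>i a c. F i a c - F' i a c"]) auto
qed

text \<open>The rank-one matrix \<open>u u*\<close> placed in every block of type \<open>i\<close>.
  It is an orthogonal projection when \<open>u\<close> is a unit vector of length
  \<open>sz i\<close>.\<close>

definition proj :: "nat \<Rightarrow> (nat \<Rightarrow> complex) \<Rightarrow> complex mat" where
  "proj i u = mat d d (\<lambda>(s, t). if blk s = blk t \<and> ty (blk s) = i then u (off s) * cnj (u (off t)) else 0)"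

lemma proj_carrier [simp]: "proj i u \<in> carrier_mat d d"
  by (simp add: proj_def)

lemma proj_in_alg: "proj i u \<in> alg"
  by (rule algI[where F = "\<lambda>j a c. if j = i then u a * cnj (u c) else 0"]) (auto simp: proj_def)

lemma proj_adjoint: "mat_adjoint (proj i u) = proj i u"
proof (rule eq_matI)
  fix s t assume "s < dim_row (proj i u)" "t < dim_col (proj i u)"
  then have "s < d" "t < d" by (auto simp: proj_def)
  then show "mat_adjoint (proj i u) $$ (s, t) = proj i u $$ (s, t)"
    unfolding mat_adjoint_index[OF proj_carrier \<open>s < d\<close> \<open>t < d\<close>] by (auto simp: proj_def)
qed (auto simp: mat_adjoint_def proj_def)

lemma proj_idem:
  assumes u: "fnorm (sz i) u = 1"
  shows "proj i u * proj i u = proj i u"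
proof (rule eq_matI)
  fix s t assume "s < dim_row (proj i u)" "t < dim_col (proj i u)"
  then have st: "s < d" "t < d" by (auto simp: proj_def)
  let ?e = "if blk s = blk t \<and> ty (blk s) = i then u (off s) * cnj (u (off t)) else 0"
  have "(proj i u * proj i u) $$ (s, t) = (\<Sum>r<d. proj i u $$ (s, r) * proj i u $$ (r, t))"
    using st by (simp add: proj_def scalar_prod_def atLeast0LessThan)
  also have "\<dots> = (\<Sum>r<d. if blk r = blk s then ?e * (u (off r) * cnj (u (off r))) else 0)"
    using st by (intro sum.cong) (auto simp: proj_def)
  also have "\<dots> = (\<Sum>a<sz (ty (blk s)). ?e * (u a * cnj (u a)))"
    unfolding sum_block[OF blk_less[OF st(1)]] using st by (intro sum.cong) simp_all
  also have "\<dots> = ?e * ip (sz (ty (blk s))) u u"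
    by (simp add: ip_def sum_distrib_left)
  also have "\<dots> = proj i u $$ (s, t)" using st u by (auto simp: proj_def ip_self)
  finally show "(proj i u * proj i u) $$ (s, t) = proj i u $$ (s, t)" .
qed (auto simp: proj_def)

text \<open>Each of the blocks of this type contributes the trace of \<open>u u* F\<close>, which is
  the value at \<open>u\<close> of the quadratic form of the block matrix \<open>F\<close>.\<close>

lemma trace_proj_mult:
  assumes A: "A \<in> carrier_mat d d" and b0: "b0 < R"
    and F: "\<And>s t. s < d \<Longrightarrow> t < d \<Longrightarrow> A $$ (s, t) = (if blk s = blk t then F (ty (blk s)) (off s) (off t) else 0)"
  shows "mat_trace (proj (ty b0) u * A)
    = of_nat (card (cls b0)) * ip (sz (ty b0)) (mv (mat (sz (ty b0)) (sz (ty b0)) (\<lambda>(a, c). F (ty b0) a c)) u) u"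
proof -
  let ?S = "\<Sum>a<sz (ty b0). \<Sum>c<sz (ty b0). u a * cnj (u c) * F (ty b0) c a"
  have "mat_trace (proj (ty b0) u * A) = (\<Sum>s<d. \<Sum>t<d. proj (ty b0) u $$ (s, t) * A $$ (t, s))"
    using A by (auto simp: mat_trace_def proj_def scalar_prod_def atLeast0LessThan intro!: sum.cong)
  also have "\<dots> = (\<Sum>s<d. \<Sum>t<d. if blk t = blk s then (if ty (blk s) = ty b0
      then u (off s) * cnj (u (off t)) * F (ty b0) (off t) (off s) else 0) else 0)"
    by (intro sum.cong) (auto simp: proj_def F)
  also have "\<dots> = (\<Sum>s<d. \<Sum>c<sz (ty (blk s)). if ty (blk s) = ty b0
      then u (off s) * cnj (u c) * F (ty b0) c (off s) else 0)"
    by (rule sum.cong[OF refl], subst sum_block) (auto intro!: sum.cong)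
  also have "\<dots> = (\<Sum>b<R. \<Sum>a<sz (ty b). \<Sum>c<sz (ty b). if ty b = ty b0
      then u a * cnj (u c) * F (ty b0) c a else 0)"
    by (auto simp: sum_index intro!: sum.cong)
  also have "\<dots> = (\<Sum>b<R. if ty b = ty b0 then ?S else 0)"
    by (intro sum.cong) auto
  also have "\<dots> = (\<Sum>b\<in>{b\<in>{..<R}. ty b = ty b0}. ?S)"
    by (simp only: sum.inter_filter finite_lessThan)
  also have "{b\<in>{..<R}. ty b = ty b0} = cls b0" by (auto simp: cls_def)
  also have "?S = (\<Sum>c<sz (ty b0). \<Sum>a<sz (ty b0). u a * cnj (u c) * F (ty b0) c a)"
    by (rule sum.swap)
  also have "\<dots> = ip (sz (ty b0)) (mv (mat (sz (ty b0)) (sz (ty b0)) (\<lambda>(a, c). F (ty b0) a c)) u) u"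
    by (auto simp: ip_def mv_def sum_distrib_left sum_distrib_right algebra_simps intro!: sum.cong)
  finally show ?thesis by simp
qed

text \<open>With \<open>q = proj (ty b) u\<close> the trace is a positive multiple of the quadratic
  form of a single block at \<open>u\<close>. Letting \<open>u\<close> run over the unit vectors
  makes that block vanish.\<close>

lemma alg_separation:
  assumes A: "A \<in> alg"
    and 0: "\<And>q. q \<in> alg \<Longrightarrow> mat_adjoint q = q \<Longrightarrow> q * q = q \<Longrightarrow> mat_trace (q * A) = 0"
  shows "A = 0\<^sub>m d d"
proof -
  obtain F where F: "\<And>s t. s < d \<Longrightarrow> t < d \<Longrightarrow>
     A $$ (s, t) = (if blk s = blk t then F (ty (blk s)) (off s) (off t) else 0)"
    using A unfolding alg_def by blast
  have z: "mat (sz (ty b)) (sz (ty b)) (\<lambda>(a, c). F (ty b) a c) = 0\<^sub>m (sz (ty b)) (sz (ty b))" if b: "b < R" for b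
  proof (rule zero_mat_if_quadratic_form_zero)
    fix u assume u: "fnorm (sz (ty b)) u = 1"
    have "mat_trace (proj (ty b) u * A) = 0"
      by (intro 0 proj_in_alg proj_adjoint proj_idem u)
    then show "ip (sz (ty b)) (mv (mat (sz (ty b)) (sz (ty b)) (\<lambda>(a, c). F (ty b) a c)) u) u = 0"
      using trace_proj_mult[OF alg_carrier[OF A] b F, of u] self_in_cls[OF b] by auto
  qed simp
  show ?thesis
  proof (rule eq_matI)
    fix s t assume "s < dim_row (0\<^sub>m d d)" "t < dim_col (0\<^sub>m d d)"
    then have st: "s < d" "t < d" by auto
    have "F (ty (blk s)) (off s) (off t) = 0" if "blk s = blk t"
      using arg_cong[OF z[of "blk s"], of "\<lambda>M. M $$ (off s, off t)"] st that off_less[of t] off_less[of s] by (simp del: off_less)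
    then show "A $$ (s, t) = 0\<^sub>m d d $$ (s, t)" using st by (simp add: F)
  qed (use alg_carrier[OF A] in auto)
qed

end

subsection \<open>Block indices of a refined partition\<close>

text \<open>Entry number \<open>s\<close> is the pair (block, offset) of coordinate \<open>s\<close>
  when the blocks have the listed sizes. The recursion follows that of
  \<open>diag_block_mat\<close>, which puts one block in front and moves all later blocks up by
  one.\<close>

fun index_labels :: "nat list \<Rightarrow> (nat \<times> nat) list" where
  "index_labels [] = []"
| "index_labels (n # ns) = map (Pair 0) [0..<n] @ map (apfst Suc) (index_labels ns)"

lemma length_index_labels: "length (index_labels ns) = sum_list ns"
  by (induction ns) auto

lemma set_index_labels: "set (index_labels ns) = (SIGMA b:{..<length ns}. {..<ns ! b})"
proof (induction ns)
  case (Cons n ns)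
  show ?case
  proof (rule Set.set_eqI)
    fix x :: "nat \<times> nat"
    obtain b a where x: "x = (b, a)" by (cases x)
    show "x \<in> set (index_labels (n # ns)) \<longleftrightarrow> x \<in> (SIGMA b:{..<length (n # ns)}. {..<(n # ns) ! b})"
      using Cons by (cases b) (auto simp: x image_iff apfst_def map_prod_def)
  qed
qed simp

lemma distinct_index_labels: "distinct (index_labels ns)"
  by (induction ns) (auto simp: distinct_map inj_on_def)

lemma index_diag_block_mat:
  assumes "\<And>A. A \<in> set As \<Longrightarrow> dim_col A = dim_row A" and "ls = index_labels (map dim_row As)"
    and "s < length ls" "t < length ls"
  shows "diag_block_mat As $$ (s, t)
    = (if fst (ls ! s) = fst (ls ! t) then As ! fst (ls ! s) $$ (snd (ls ! s), snd (ls ! t)) else 0)"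
  using assms
proof (induction As arbitrary: s t ls)
  case (Cons A As)
  let ?D = "diag_block_mat As" and ?ls = "index_labels (map dim_row As)"
  have dim: "dim_row ?D = length ?ls" "dim_col ?D = length ?ls"
    using Cons.prems(1) by (auto simp: dim_diag_block_mat length_index_labels intro!: arg_cong[of _ _ sum_list])
  have A: "dim_col A = dim_row A" using Cons.prems(1) by simp
  have ls: "length ls = dim_row A + length ?ls" using Cons.prems(2) by simp
  have nth: "ls ! s = (if s < dim_row A then (0, s) else apfst Suc (?ls ! (s - dim_row A)))"
    if "s < length ls" for s
    using that Cons.prems(2) by (auto simp: nth_append)
  have IH: "?D $$ (s, t) = (if fst (?ls ! s) = fst (?ls ! t) then As ! fst (?ls ! s) $$ (snd (?ls ! s), snd (?ls ! t)) else 0)"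
    if "s < length ?ls" "t < length ?ls" for s t
    using Cons.IH[OF _ refl that] Cons.prems(1) by simp
  show ?case
    using Cons.prems(3,4) by (simp add: Let_def dim A ls nth IH)
qed simp

text \<open>The type of a block is a position in \<open>p\<close> and not a block size, so entries
  of \<open>p\<close> with equal sizes remain independent of each other.\<close>

definition block_types :: "rpart \<Rightarrow> nat list" where
  "block_types p = concat (map (\<lambda>i. replicate (snd (p ! i)) i) [0..<length p])"

lemma map_nth_upt: "map (\<lambda>i. f (xs ! i)) [0..<length xs] = map f xs"
  by (rule nth_equalityI) auto

lemma set_block_types: "i \<in> set (block_types p) \<Longrightarrow> i < length p"
  by (auto simp: block_types_def)

lemma length_block_types: "length (block_types p) = (\<Sum>(n, m)\<leftarrow>p. m)"
  using map_nth_upt[of snd p] by (simp add: block_types_def length_concat o_def case_prod_unfold)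

lemma sum_list_block_sizes: "sum_list (map (\<lambda>i. fst (p ! i)) (block_types p)) = (\<Sum>(n, m)\<leftarrow>p. m * n)"
proof -
  have "sum_list (map g (block_types p)) = (\<Sum>i\<leftarrow>[0..<length p]. snd (p ! i) * g i)" for g :: "nat \<Rightarrow> nat"
  proof -
    have "sum_list (map g (concat (map (\<lambda>i. replicate (snd (p ! i)) i) is))) = (\<Sum>i\<leftarrow>is. snd (p ! i) * g i)" for "is"
      by (induction "is") (auto simp: sum_list_replicate)
    then show ?thesis by (simp add: block_types_def)
  qed
  from this[of "\<lambda>i. fst (p ! i)"] show ?thesis
    using map_nth_upt[of "\<lambda>x. snd x * fst x" p] by (simp add: case_prod_unfold)
qed

lemma card_block_types: "i < length p \<Longrightarrow> card {b. b < length (block_types p) \<and> block_types p ! b = i} = snd (p ! i)"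
proof -
  assume i: "i < length p"
  have "length (filter (\<lambda>j. j = i) (concat (map (\<lambda>j. replicate (snd (p ! j)) j) is)))
      = (\<Sum>j\<leftarrow>is. if j = i then snd (p ! j) else 0)" for "is"
    by (induction "is") auto
  then have "length (filter (\<lambda>j. j = i) (block_types p)) = (\<Sum>j\<leftarrow>[0..<length p]. if j = i then snd (p ! j) else 0)"
    by (simp add: block_types_def)
  also have "\<dots> = snd (p ! i)"
    using i by (simp add: interv_sum_list_conv_sum_set_nat)
  finally show ?thesis by (simp add: length_filter_conv_card)
qed

lemma block_list_eq:
  assumes "length As = length p"
  shows "concat (map2 (\<lambda>(ni, mi) A. replicate mi A) p As) = map (\<lambda>i. As ! i) (block_types p)"
proof -
  have "map2 (\<lambda>(ni, mi) A. replicate mi A) p As = map (\<lambda>i. replicate (snd (p ! i)) (As ! i)) [0..<length p]"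
    using assms by (intro nth_equalityI) (auto simp: case_prod_unfold)
  then show ?thesis by (simp add: block_types_def map_concat o_def)
qed

text \<open>The bridge from lists of blocks to formulas for entries: a list \<open>As\<close> of
  blocks and a function \<open>F\<close> of type and two offsets determine each other as far as the
  entries of the matrix are concerned.\<close>

lemma block_subalgebra_index:
  fixes p :: rpart
  defines "ls \<equiv> index_labels (map (\<lambda>i. fst (p ! i)) (block_types p))"
  assumes p: "refined_partition p d"
  shows "block_index d (length (block_types p)) (\<lambda>s. fst (ls ! s)) (\<lambda>s. snd (ls ! s)) (\<lambda>b. block_types p ! b) (\<lambda>i. fst (p ! i))" (is ?I)
    and "block_subalgebra p = block_index.alg d (\<lambda>s. fst (ls ! s)) (\<lambda>s. snd (ls ! s)) (\<lambda>b. block_types p ! b)" (is ?A)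
proof -
  have len: "length ls = d"
    using p by (simp add: ls_def length_index_labels sum_list_block_sizes refined_partition_def)
  have "bij_betw (\<lambda>s. ls ! s) {..<d} (set ls)"
    using len by (intro bij_betw_nth) (auto simp: ls_def distinct_index_labels)
  also have "set ls = (SIGMA b:{..<length (block_types p)}. {..<fst (p ! (block_types p ! b))})"
    by (auto simp: ls_def set_index_labels)
  finally show I: ?I by unfold_locales simp
  interpret block_index d "length (block_types p)" "\<lambda>s. fst (ls ! s)" "\<lambda>s. snd (ls ! s)" "\<lambda>b. block_types p ! b" "\<lambda>i. fst (p ! i)"
    by (rule I)
  let ?D = "\<lambda>As. diag_block_mat (map (\<lambda>i. As ! i) (block_types p))"
  have D: "?D As \<in> carrier_mat d d \<and> (\<forall>s<d. \<forall>t<d. ?D As $$ (s, t) = (if fst (ls ! s) = fst (ls ! t)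
      then As ! (block_types p ! fst (ls ! s)) $$ (snd (ls ! s), snd (ls ! t)) else 0))"
    if As: "length As = length p" "\<forall>i<length p. As ! i \<in> carrier_mat (fst (p ! i)) (fst (p ! i))" for As
  proof -
    have sz: "dim_row (As ! i) = fst (p ! i)" "dim_col (As ! i) = fst (p ! i)" if "i \<in> set (block_types p)" for i
      using As set_block_types[OF that] by auto
    have eq: "map dim_row (map (\<lambda>i. As ! i) (block_types p)) = map (\<lambda>i. fst (p ! i)) (block_types p)"
      "map dim_col (map (\<lambda>i. As ! i) (block_types p)) = map (\<lambda>i. fst (p ! i)) (block_types p)"
      using sz by auto
    have "sum_list (map (\<lambda>i. fst (p ! i)) (block_types p)) = d"
      using len by (simp add: ls_def length_index_labels)
    then have "?D As \<in> carrier_mat d d"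
      by (intro carrier_matI) (simp_all only: dim_diag_block_mat eq)
    moreover have "?D As $$ (s, t) = (if fst (ls ! s) = fst (ls ! t)
      then As ! (block_types p ! fst (ls ! s)) $$ (snd (ls ! s), snd (ls ! t)) else 0)" if "s < d" "t < d" for s t
    proof -
      have "?D As $$ (s, t) = (if fst (ls ! s) = fst (ls ! t)
        then map (\<lambda>i. As ! i) (block_types p) ! fst (ls ! s) $$ (snd (ls ! s), snd (ls ! t)) else 0)"
        by (rule index_diag_block_mat) (use sz that len in \<open>auto simp: eq ls_def simp del: map_map\<close>)
      then show ?thesis using blk_less[OF that(1)] by simp
    qed
    ultimately show ?thesis by blast
  qed
  show ?A
  proof (intro equalityI subsetI)
    fix A assume "A \<in> block_subalgebra p"
    then obtain As where As: "length As = length p" "\<forall>i<length p. As ! i \<in> carrier_mat (fst (p ! i)) (fst (p ! i))"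
      and A: "A = ?D As"
      unfolding block_subalgebra_def using block_list_eq by force
    then show "A \<in> alg"
      using D[OF As] by (intro algI[where F = "\<lambda>i a c. As ! i $$ (a, c)"]) auto
  next
    fix A assume "A \<in> alg"
    then obtain F where A: "A \<in> carrier_mat d d" and F: "\<forall>s<d. \<forall>t<d. A $$ (s, t)
        = (if fst (ls ! s) = fst (ls ! t) then F (block_types p ! fst (ls ! s)) (snd (ls ! s)) (snd (ls ! t)) else 0)"
      unfolding alg_def by auto
    \<comment> \<open>\<open>F\<close> is arbitrary beyond the block sizes; cutting it off there
      gives the blocks. Only offsets below the size occur as labels.\<close>
    define As where "As = map (\<lambda>i. mat (fst (p ! i)) (fst (p ! i)) (\<lambda>(a, c). F i a c)) [0..<length p]"
    have As: "length As = length p" "\<forall>i<length p. As ! i \<in> carrier_mat (fst (p ! i)) (fst (p ! i))"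
      by (auto simp: As_def)
    have "?D As = A"
    proof (rule eq_matI)
      fix s t assume "s < dim_row A" "t < dim_col A"
      then have st: "s < d" "t < d" using A by auto
      have "block_types p ! fst (ls ! s) < length p"
        using blk_less[OF st(1)] by (intro set_block_types nth_mem)
      then show "?D As $$ (s, t) = A $$ (s, t)"
        using D[OF As] F st off_less[OF st(1)] off_less[OF st(2)] by (auto simp: As_def simp del: off_less)
    qed (use D[OF As] A in auto)
    then show "A \<in> block_subalgebra p"
      unfolding block_subalgebra_def using As block_list_eq[OF As(1)] by (intro CollectI exI[of _ As]) auto
  qed
qed

text \<open>From here on the subalgebra is used through these properties, without labels.\<close>

lemma block_subalgebra_facts:
  assumes p: "refined_partition p n"
  shows block_subalgebra_carrier: "block_subalgebra p \<subseteq> carrier_mat n n"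
    and zero_in_block_subalgebra: "0\<^sub>m n n \<in> block_subalgebra p"
    and one_in_block_subalgebra: "1\<^sub>m n \<in> block_subalgebra p"
    and diff_in_block_subalgebra: "\<And>A A'. A \<in> block_subalgebra p \<Longrightarrow> A' \<in> block_subalgebra p \<Longrightarrow> A - A' \<in> block_subalgebra p"
    and block_subalgebra_separation: "\<And>A. A \<in> block_subalgebra p \<Longrightarrow>
      (\<And>q. q \<in> block_subalgebra p \<Longrightarrow> mat_adjoint q = q \<Longrightarrow> q * q = q \<Longrightarrow> mat_trace (q * A) = 0) \<Longrightarrow> A = 0\<^sub>m n n"
proof -
  note I = block_subalgebra_index[OF p]
  interpret block_index n "length (block_types p)"
    "\<lambda>s. fst (index_labels (map (\<lambda>i. fst (p ! i)) (block_types p)) ! s)"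
    "\<lambda>s. snd (index_labels (map (\<lambda>i. fst (p ! i)) (block_types p)) ! s)"
    "\<lambda>b. block_types p ! b" "\<lambda>i. fst (p ! i)"
    by (rule I(1))
  show "block_subalgebra p \<subseteq> carrier_mat n n" "0\<^sub>m n n \<in> block_subalgebra p" "1\<^sub>m n \<in> block_subalgebra p"
    "\<And>A A'. A \<in> block_subalgebra p \<Longrightarrow> A' \<in> block_subalgebra p \<Longrightarrow> A - A' \<in> block_subalgebra p"
    "\<And>A. A \<in> block_subalgebra p \<Longrightarrow>
      (\<And>q. q \<in> block_subalgebra p \<Longrightarrow> mat_adjoint q = q \<Longrightarrow> q * q = q \<Longrightarrow> mat_trace (q * A) = 0) \<Longrightarrow> A = 0\<^sub>m n n"
    unfolding I(2) using alg_carrier zero_in_alg one_in_alg diff_in_alg alg_separation by blast+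
qed

text \<open>The witness is \<open>avg\<close>. The number of blocks is the sum of the
  multiplicities, and the class of a block has as many members as the multiplicity of its type, so
  \<open>M\<close> bounds the class sizes.\<close>

lemma ex_block_average:
  assumes p: "refined_partition p n" and M: "\<And>n' m. (n', m) \<in> set p \<Longrightarrow> m \<le> M"
  shows "\<exists>E. (\<forall>X. E X \<in> block_subalgebra p) \<and>
    (\<forall>X\<in>carrier_mat n n. \<forall>Y\<in>carrier_mat n n. E (X + Y) = E X + E Y) \<and>
    (\<forall>c. \<forall>X\<in>carrier_mat n n. E (c \<cdot>\<^sub>m X) = c \<cdot>\<^sub>m E X) \<and>
    (\<forall>X\<in>block_subalgebra p. E X = X) \<and>
    (\<forall>X\<in>carrier_mat n n. mat_trace (E X) = mat_trace X) \<and>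
    (\<forall>X\<in>carrier_mat n n. mat_opnorm (E X) \<le> mat_opnorm X) \<and>
    (\<forall>X\<in>carrier_mat n n. psd X \<longrightarrow> mat_opnorm X \<le> real (\<Sum>(n, m)\<leftarrow>p. m) * real M * mat_opnorm (E X))"
proof -
  note I = block_subalgebra_index[OF p]
  interpret block_index n "length (block_types p)"
    "\<lambda>s. fst (index_labels (map (\<lambda>i. fst (p ! i)) (block_types p)) ! s)"
    "\<lambda>s. snd (index_labels (map (\<lambda>i. fst (p ! i)) (block_types p)) ! s)"
    "\<lambda>b. block_types p ! b" "\<lambda>i. fst (p ! i)"
    by (rule I(1))
  have "card (cls b) \<le> M" if "b < length (block_types p)" for b
  proof -
    have i: "block_types p ! b < length p" using that by (intro set_block_types nth_mem)
    then have "card (cls b) = snd (p ! (block_types p ! b))"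
      unfolding cls_def by (rule card_block_types)
    also have "\<dots> \<le> M" using M nth_mem[OF i] by (metis prod.collapse)
    finally show ?thesis .
  qed
  then show ?thesis
    unfolding I(2) length_block_types[symmetric]
    by (intro exI[of _ avg] conjI ballI allI impI avg_in_alg avg_add avg_smult avg_alg trace_avg avg_opnorm_le psd_opnorm_le_avg)
qed

subsection \<open>Uniqueness of the conditional expectation\<close>

lemma mat_trace_mult_comm:
  assumes "A \<in> carrier_mat n n" "B \<in> carrier_mat n n"
  shows "mat_trace (A * B) = mat_trace (B * A)"
proof -
  have "mat_trace (A * B) = (\<Sum>s<n. \<Sum>t<n. A $$ (s, t) * B $$ (t, s))"
    using assms by (auto simp: mat_trace_def scalar_prod_def atLeast0LessThan intro!: sum.cong)
  also have "\<dots> = (\<Sum>t<n. \<Sum>s<n. A $$ (s, t) * B $$ (t, s))"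
    by (rule sum.swap)
  also have "\<dots> = mat_trace (B * A)"
    using assms by (auto simp: mat_trace_def scalar_prod_def atLeast0LessThan mult.commute intro!: sum.cong)
  finally show ?thesis .
qed

lemma mat_trace_add: "A \<in> carrier_mat n n \<Longrightarrow> B \<in> carrier_mat n n \<Longrightarrow> mat_trace (A + B) = mat_trace A + mat_trace B"
  by (auto simp: mat_trace_def sum.distrib)

lemma mat_trace_smult: "A \<in> carrier_mat n n \<Longrightarrow> mat_trace (c \<cdot>\<^sub>m A) = c * mat_trace A"
  by (auto simp: mat_trace_def sum_distrib_left)

section \<open>Orthogonal projections: trace and norm\<close>

definition mat_proj :: "complex mat \<Rightarrow> bool" where
  "mat_proj q \<longleftrightarrow> mat_adjoint q = q \<and> q * q = q"

lemma mat_proj_ip: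
  assumes "q \<in> carrier_mat n n" "mat_proj q"
  shows "ip n (mv q x) y = ip n x (mv q y)"
  using ip_mv_adjoint[OF assms(1)] assms(2) by (simp add: mat_proj_def)

lemma mat_proj_mv:
  assumes "q \<in> carrier_mat n n" "mat_proj q" "s < n"
  shows "mv q (mv q x) s = mv q x s"
  using mv_mult[OF assms(1,1,3)] assms(2) by (simp add: mat_proj_def)

lemma mat_proj_fnorm_sq:
  assumes q: "q \<in> carrier_mat n n" "mat_proj q"
  shows "ip n (mv q x) x = of_real ((fnorm n (mv q x))\<^sup>2)"
proof -
  have "ip n (mv q x) x = ip n (mv q (mv q x)) x"
    by (intro ip_cong) (auto simp: mat_proj_mv[OF q])
  then show ?thesis by (simp add: mat_proj_ip[OF q] ip_self)
qed

lemma mat_proj_Pythagoras: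
  assumes q: "q \<in> carrier_mat n n" "mat_proj q"
  shows "(fnorm n x)\<^sup>2 = (fnorm n (mv q x))\<^sup>2 + (fnorm n (\<lambda>s. x s - mv q x s))\<^sup>2"
proof -
  have "ip n x (mv q x) = ip n (mv q x) x" by (simp add: mat_proj_ip[OF q])
  then have "complex_of_real ((fnorm n (\<lambda>s. x s - mv q x s))\<^sup>2) = of_real ((fnorm n x)\<^sup>2 - (fnorm n (mv q x))\<^sup>2)"
    using mat_proj_fnorm_sq[OF q, of x]
    unfolding ip_self[symmetric] ip_diff_left ip_diff_right of_real_diff by (simp add: ip_self)
  then show ?thesis by (simp only: of_real_eq_iff)
qed

text \<open>By cyclicity the trace of \<open>q Z\<close> is that of \<open>q Z q\<close>, the sum of
  the form of \<open>Z\<close> at the vectors \<open>q e_s\<close>; the squared norms of these same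
  vectors sum to the trace of \<open>q\<close>.\<close>

lemma mat_proj_trace_bound:
  assumes q: "q \<in> carrier_mat n n" "mat_proj q" and Z: "Z \<in> carrier_mat n n"
  shows "0 \<le> mat_trace q" and "cmod (mat_trace (q * Z)) \<le> cmod (mat_trace q) * mat_opnorm Z"
proof -
  define e where "e t = (\<lambda>i. if i = t then 1 else 0 :: complex)" for t :: nat
  have trace: "mat_trace A = (\<Sum>s<n. ip n (mv A (e s)) (e s))" if "A \<in> carrier_mat n n" for A
    using that ip_mv_unit[OF that] by (auto simp: mat_trace_def e_def)
  have tr_q: "mat_trace q = of_real (\<Sum>s<n. (fnorm n (mv q (e s)))\<^sup>2)"
    by (simp add: trace[OF q(1)] mat_proj_fnorm_sq[OF q])
  then show "0 \<le> mat_trace q" by (simp add: less_eq_complex_def sum_nonneg del: of_real_sum)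
  have "mat_trace (q * Z) = mat_trace (q * (q * Z))"
    using q Z by (simp add: mat_proj_def flip: assoc_mult_mat[where n\<^sub>1=n and n\<^sub>2=n and n\<^sub>3=n and n\<^sub>4=n])
  also have "\<dots> = mat_trace (q * Z * q)"
    using q Z by (intro mat_trace_mult_comm) auto
  also have "\<dots> = (\<Sum>s<n. ip n (mv Z (mv q (e s))) (mv q (e s)))"
  proof -
    have "ip n (mv (q * Z * q) x) y = ip n (mv Z (mv q x)) (mv q y)" for x y
    proof -
      have "ip n (mv (q * Z * q) x) y = ip n (mv (q * Z) (mv q x)) y"
        using q Z by (intro ip_cong mv_mult[where n=n and m=n and p=n]) auto
      also have "\<dots> = ip n (mv q (mv Z (mv q x))) y"
        using q Z by (intro ip_cong mv_mult[where n=n and m=n and p=n]) auto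
      finally show ?thesis by (simp add: mat_proj_ip[OF q])
    qed
    then show ?thesis using q Z by (subst trace) auto
  qed
  also have "cmod \<dots> \<le> (\<Sum>s<n. mat_opnorm Z * (fnorm n (mv q (e s)))\<^sup>2)"
    using ip_mv_le[OF Z] by (intro sum_norm_le) (simp add: power2_eq_square)
  also have "\<dots> = cmod (mat_trace q) * mat_opnorm Z"
    unfolding tr_q norm_of_real by (simp add: sum_nonneg sum_distrib_left mult.commute)
  finally show "cmod (mat_trace (q * Z)) \<le> cmod (mat_trace q) * mat_opnorm Z" .
qed

text \<open>If \<open>Y q = 0\<close>, then \<open>Y\<close> sees only \<open>x - q x\<close>, and
  Cauchy-Schwarz in the plane combines with Pythagoras. If \<open>q Y = 0\<close>, the vectors
  \<open>c q x\<close> and \<open>Y x\<close> are orthogonal, so their squared norms add up.\<close>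

lemma opnorm_proj_add:
  assumes q: "q \<in> carrier_mat n n" "mat_proj q" and Y: "Y \<in> carrier_mat n n"
    and 0: "Y * q = 0\<^sub>m n n \<or> q * Y = 0\<^sub>m n n" and le: "mat_opnorm Y \<le> y"
  shows "mat_opnorm (c \<cdot>\<^sub>m q + Y) \<le> sqrt ((cmod c)\<^sup>2 + y\<^sup>2)"
proof (rule mat_opnorm_leI)
  show "c \<cdot>\<^sub>m q + Y \<in> carrier_mat n n" using q Y by auto
next
  fix x
  let ?p = "fnorm n (mv q x)"
  have y0: "0 \<le> y" using mat_opnorm_nonneg[OF Y] le by linarith
  have Yle: "fnorm n (mv Y z) \<le> y * fnorm n z" for z
    by (rule order_trans[OF fnorm_mv_le[OF Y]]) (simp add: mult_right_mono le)
  have eq: "fnorm n (mv (c \<cdot>\<^sub>m q + Y) x) = fnorm n (\<lambda>s. c * mv q x s + mv Y x s)"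
    using q Y by (intro fnorm_cong) (auto simp: mv_def algebra_simps sum.distrib sum_distrib_left intro!: sum.cong)
  have mv0: "mv (0\<^sub>m n n) z s = 0" if "s < n" for z s
    using that by (simp add: mv_def)
  have "(fnorm n (\<lambda>s. c * mv q x s + mv Y x s))\<^sup>2 \<le> ((cmod c)\<^sup>2 + y\<^sup>2) * (fnorm n x)\<^sup>2"
    using 0
  proof
    assume 0: "Y * q = 0\<^sub>m n n"
    let ?r = "fnorm n (\<lambda>s. x s - mv q x s)"
    have "mv Y (mv q x) s = 0" if "s < n" for s
      using mv_mult[OF Y q(1) that, of x] mv0[OF that, of x] by (simp add: 0)
    then have "fnorm n (mv Y x) = fnorm n (mv Y (\<lambda>s. x s - mv q x s))"
      by (intro fnorm_cong) (simp add: mv_diff)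
    also have "\<dots> \<le> y * ?r" by (rule Yle)
    finally have "fnorm n (\<lambda>s. c * mv q x s + mv Y x s) \<le> cmod c * ?p + y * ?r"
      using fnorm_triangle[of n "\<lambda>s. c * mv q x s" "mv Y x"] by (simp add: fnorm_scale)
    then have "(fnorm n (\<lambda>s. c * mv q x s + mv Y x s))\<^sup>2 \<le> (cmod c * ?p + y * ?r)\<^sup>2"
      by (intro power_mono) auto
    \<comment> \<open>Lagrange's identity for the two pairs, with Cauchy-Schwarz as the
      consequence.\<close>
    also have "\<dots> = ((cmod c)\<^sup>2 + y\<^sup>2) * (?p\<^sup>2 + ?r\<^sup>2) - (cmod c * ?r - y * ?p)\<^sup>2"
      by (simp add: power2_eq_square algebra_simps)
    also have "\<dots> \<le> ((cmod c)\<^sup>2 + y\<^sup>2) * (?p\<^sup>2 + ?r\<^sup>2)" by simp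
    finally show ?thesis by (simp only: mat_proj_Pythagoras[OF q, of x])
  next
    assume 0: "q * Y = 0\<^sub>m n n"
    have "ip n (mv Y x) (mv q x) = ip n (mv q (mv Y x)) x" by (simp add: mat_proj_ip[OF q])
    also have "\<dots> = ip n (\<lambda>s. 0) x"
      using mv_mult[OF q(1) Y, of _ x] mv0[of _ x] by (intro ip_cong) (auto simp: 0)
    finally have "ip n (mv Y x) (mv q x) = 0" by (simp add: ip_def)
    moreover from this have "ip n (mv q x) (mv Y x) = 0" using ip_cnj complex_cnj_zero by metis
    ultimately have "complex_of_real ((fnorm n (\<lambda>s. c * mv q x s + mv Y x s))\<^sup>2)
        = of_real ((cmod c)\<^sup>2 * ?p\<^sup>2 + (fnorm n (mv Y x))\<^sup>2)"
      unfolding ip_self[symmetric] ip_add_left ip_add_right ip_scale_left ip_scale_right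
      by (simp add: ip_self complex_norm_square[symmetric])
    then have "(fnorm n (\<lambda>s. c * mv q x s + mv Y x s))\<^sup>2 = (cmod c)\<^sup>2 * ?p\<^sup>2 + (fnorm n (mv Y x))\<^sup>2"
      by (simp only: of_real_eq_iff)
    also have "\<dots> \<le> (cmod c)\<^sup>2 * (fnorm n x)\<^sup>2 + (y * fnorm n x)\<^sup>2"
      using mat_proj_Pythagoras[OF q, of x]
      by (intro add_mono mult_left_mono power_mono Yle) (auto intro: power2_le_imp_le)
    finally show ?thesis by (simp add: algebra_simps power_mult_distrib)
  qed
  also have "\<dots> = (sqrt ((cmod c)\<^sup>2 + y\<^sup>2) * fnorm n x)\<^sup>2" by (simp add: power_mult_distrib)
  finally show "fnorm n (mv (c \<cdot>\<^sub>m q + Y) x) \<le> sqrt ((cmod c)\<^sup>2 + y\<^sup>2) * fnorm n x"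
    unfolding eq by (rule power2_le_imp_le) simp
qed simp

section \<open>Direct sums and the weighted trace\<close>

lemma dsum_carrier: "X \<in> dsum N d \<Longrightarrow> k \<in> {1..N} \<Longrightarrow> X k \<in> carrier_mat (d k) (d k)"
  by (auto simp: dsum_def)

lemma dsum_restrict: "(\<And>k. k \<in> {1..N} \<Longrightarrow> f k \<in> carrier_mat (d k) (d k)) \<Longrightarrow> (\<lambda>k\<in>{1..N}. f k) \<in> dsum N d"
  by (auto simp: dsum_def)

lemma ds_closed:
  assumes "X \<in> dsum N d" "Y \<in> dsum N d"
  shows "ds_add N X Y \<in> dsum N d" "ds_smult N c X \<in> dsum N d" "ds_mult N X Y \<in> dsum N d" "ds_adjoint N X \<in> dsum N d"
  unfolding ds_add_def ds_smult_def ds_mult_def ds_adjoint_def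
  using dsum_carrier[OF assms(1)] dsum_carrier[OF assms(2)]
  by (intro dsum_restrict; auto intro!: mult_carrier_mat)+

lemma opnorm_le_ds_opnorm: "k \<in> {1..N} \<Longrightarrow> mat_opnorm (X k) \<le> ds_opnorm N X"
  unfolding ds_opnorm_def by (intro Max_ge) auto

lemma ds_opnorm_le: "1 \<le> N \<Longrightarrow> (\<And>k. k \<in> {1..N} \<Longrightarrow> mat_opnorm (X k) \<le> c) \<Longrightarrow> ds_opnorm N X \<le> c"
  unfolding ds_opnorm_def by (subst Max_le_iff) auto

lemma tau_add:
  assumes "X \<in> dsum N d" "Y \<in> dsum N d"
  shows "tau N d v (ds_add N X Y) = tau N d v X + tau N d v Y"
  unfolding tau_def ds_add_def sum.distrib[symmetric]
  using mat_trace_add[OF dsum_carrier[OF assms(1)] dsum_carrier[OF assms(2)]]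
  by (intro sum.cong) (auto simp: ring_distribs)

lemma tau_smult:
  assumes "X \<in> dsum N d"
  shows "tau N d v (ds_smult N c X) = c * tau N d v X"
  unfolding tau_def ds_smult_def sum_distrib_left
  using mat_trace_smult[OF dsum_carrier[OF assms]]
  by (intro sum.cong) auto

lemma ds_mult_add:
  assumes "q \<in> dsum N d" "X \<in> dsum N d" "Y \<in> dsum N d"
  shows "ds_mult N q (ds_add N X Y) = ds_add N (ds_mult N q X) (ds_mult N q Y)"
  unfolding ds_mult_def ds_add_def
proof (rule restrict_ext)
  fix k assume k: "k \<in> {1..N}"
  show "q k * (\<lambda>k\<in>{1..N}. X k + Y k) k = (\<lambda>k\<in>{1..N}. q k * X k) k + (\<lambda>k\<in>{1..N}. q k * Y k) k"
    using k mult_add_distrib_mat[OF assms[THEN dsum_carrier, OF k]] by simp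
qed

lemma ds_mult_smult:
  assumes "q \<in> dsum N d" "X \<in> dsum N d"
  shows "ds_mult N q (ds_smult N c X) = ds_smult N c (ds_mult N q X)"
  unfolding ds_mult_def ds_smult_def
proof (rule restrict_ext)
  fix k assume k: "k \<in> {1..N}"
  show "q k * (\<lambda>k\<in>{1..N}. c \<cdot>\<^sub>m X k) k = c \<cdot>\<^sub>m (\<lambda>k\<in>{1..N}. q k * X k) k"
    using k mult_smult_distrib[OF assms[THEN dsum_carrier, OF k]] by simp
qed

text \<open>Weights and traces of projections are nonnegative reals, so no cancellation occurs and
  \<open>tau N d v q\<close> may be replaced by its modulus.\<close>

lemma tau_proj:
  assumes v: "\<And>k. k \<in> {1..N} \<Longrightarrow> 0 \<le> v k" and q: "q \<in> dsum N d" "\<And>k. k \<in> {1..N} \<Longrightarrow> mat_proj (q k)"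
  shows "tau N d v q = of_real (cmod (tau N d v q))"
    and "cmod (tau N d v q) = (\<Sum>k=1..N. v k / d k * cmod (mat_trace (q k)))"
proof -
  let ?t = "\<Sum>k=1..N. v k / d k * cmod (mat_trace (q k))"
  have "mat_trace (q k) = of_real (cmod (mat_trace (q k)))" if k: "k \<in> {1..N}" for k
    using mat_proj_trace_bound(1)[OF dsum_carrier[OF q(1) k] q(2)[OF k] dsum_carrier[OF q(1) k]]
    by (auto simp: less_eq_complex_def complex_eq_iff cmod_eq_Re)
  then have "tau N d v q = of_real ?t" by (simp add: tau_def)
  moreover have "0 \<le> ?t"
    by (intro sum_nonneg mult_nonneg_nonneg divide_nonneg_nonneg v) auto
  ultimately show "tau N d v q = of_real (cmod (tau N d v q))" "cmod (tau N d v q) = ?t"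
    by (simp_all only: norm_of_real abs_of_nonneg)
qed

lemma tau_proj_mult_le:
  assumes v: "\<And>k. k \<in> {1..N} \<Longrightarrow> 0 \<le> v k" and q: "q \<in> dsum N d" "\<And>k. k \<in> {1..N} \<Longrightarrow> mat_proj (q k)"
    and Z: "Z \<in> dsum N d"
  shows "cmod (tau N d v (ds_mult N q Z)) \<le> cmod (tau N d v q) * ds_opnorm N Z"
proof -
  have T: "cmod (tau N d v q) = (\<Sum>k=1..N. v k / d k * cmod (mat_trace (q k)))"
    by (rule tau_proj(2)[OF v q])
  show ?thesis
    unfolding T sum_distrib_right unfolding tau_def
  proof (rule sum_norm_le)
    fix k assume k: "k \<in> {1..N}"
    have "cmod (mat_trace (q k * Z k)) \<le> cmod (mat_trace (q k)) * mat_opnorm (Z k)"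
      using dsum_carrier[OF _ k] q Z k by (intro mat_proj_trace_bound) auto
    also have "\<dots> \<le> cmod (mat_trace (q k)) * ds_opnorm N Z"
      by (intro mult_left_mono opnorm_le_ds_opnorm k) auto
    finally have "v k / d k * cmod (mat_trace (q k * Z k)) \<le> v k / d k * (cmod (mat_trace (q k)) * ds_opnorm N Z)"
      using v[OF k] by (intro mult_left_mono) auto
    then show "cmod (complex_of_real (v k / real (d k)) * mat_trace (ds_mult N q Z k))
        \<le> v k / real (d k) * cmod (mat_trace (q k)) * ds_opnorm N Z"
      using k v[OF k] by (simp add: ds_mult_def norm_mult norm_divide)
  qed
qed

text \<open>Let \<open>c = s w\<close> with real \<open>s\<close>. As \<open>s\<close> grows, the
  left side exceeds \<open>t * cmod c\<close> by the constant amount \<open>cmod w\<close>, whereas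
  the excess of the right side tends to 0. An explicit \<open>s\<close> replaces the limit.\<close>

lemma zero_if_norm_attained:
  fixes w :: complex and t y :: real
  assumes "0 \<le> t" and le: "\<And>c. cmod (c * of_real t + w) \<le> t * sqrt ((cmod c)\<^sup>2 + y\<^sup>2)"
  shows "w = 0"
proof (rule ccontr)
  assume w: "w \<noteq> 0"
  \<comment> \<open>Chosen so that, after squaring, the mixed term
    \<open>2 * s * t * (cmod w)^2\<close> on the left cancels \<open>t^2 * y^2\<close> on the right;
    what remains is that the square of \<open>cmod w\<close> is at most 0.\<close>
  define s where "s = t * y\<^sup>2 / (2 * (cmod w)\<^sup>2)"
  have s: "0 \<le> s" "2 * s * (cmod w)\<^sup>2 = t * y\<^sup>2" using w \<open>0 \<le> t\<close> by (auto simp: s_def)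
  have "of_real s * w * of_real t + w = of_real (s * t + 1) * w" by (simp add: algebra_simps)
  then have "cmod (of_real s * w * of_real t + w) = \<bar>s * t + 1\<bar> * cmod w" by (simp only: norm_mult norm_of_real)
  then have "(s * t + 1) * cmod w \<le> t * sqrt ((s * cmod w)\<^sup>2 + y\<^sup>2)"
    using le[of "of_real s * w"] s(1) \<open>0 \<le> t\<close> by (simp add: norm_mult)
  then have "((s * t + 1) * cmod w)\<^sup>2 \<le> (t * sqrt ((s * cmod w)\<^sup>2 + y\<^sup>2))\<^sup>2"
    using s(1) \<open>0 \<le> t\<close> by (intro power_mono) auto
  also have "\<dots> = t\<^sup>2 * (s * cmod w)\<^sup>2 + t * (t * y\<^sup>2)"
    unfolding power_mult_distrib[of t "sqrt _"] by (simp add: algebra_simps power2_eq_square[of t])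
  also have "\<dots> = (t * s * cmod w)\<^sup>2 + 2 * s * t * (cmod w)\<^sup>2"
    unfolding s(2)[symmetric] by (simp add: power2_eq_square)
  finally have "(cmod w)\<^sup>2 \<le> 0" by (simp add: power2_eq_square algebra_simps)
  with w show False by simp
qed

text \<open>The functional \<open>X \<mapsto> tau (q * P X)\<close> attains its norm at the projection \<open>q\<close>, which forces it to
  vanish on everything that \<open>q\<close> annihilates from one side.\<close>

lemma cond_expectation_annihilated:
  assumes N: "1 \<le> N" and v: "\<And>k. k \<in> {1..N} \<Longrightarrow> 0 \<le> v k" and BA: "B \<subseteq> dsum N d"
    and P: "cond_expectation N d B P"
    and q: "q \<in> B" "\<And>k. k \<in> {1..N} \<Longrightarrow> mat_proj (q k)"
    and Y: "Y \<in> dsum N d"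
    and 0: "\<And>k. k \<in> {1..N} \<Longrightarrow> Y k * q k = 0\<^sub>m (d k) (d k) \<or> q k * Y k = 0\<^sub>m (d k) (d k)"
  shows "tau N d v (ds_mult N q (P Y)) = 0"
proof (rule zero_if_norm_attained)
  fix c
  let ?t = "cmod (tau N d v q)"
  have qd: "q \<in> dsum N d" using q BA by auto
  have Pd: "P X \<in> dsum N d" if "X \<in> dsum N d" for X
    using P that BA unfolding cond_expectation_def by blast
  have cq: "ds_smult N c q \<in> dsum N d" using ds_closed[OF qd qd] by blast
  let ?X = "ds_add N (ds_smult N c q) Y"
  have X: "?X \<in> dsum N d" using ds_closed[OF cq Y] by blast
  \<comment> \<open>\<open>P\<close> fixes \<open>q\<close>, being the identity on \<open>B\<close>;
    this is where the functional takes the value \<open>?t\<close> at \<open>q\<close>.\<close>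
  have PX: "P ?X = ds_add N (ds_smult N c q) (P Y)"
    using P qd q(1) cq Y unfolding cond_expectation_def by simp
  have qq: "ds_mult N q q = q"
    using q(2) qd by (auto simp: ds_mult_def mat_proj_def dsum_def intro!: ext)
  have "complex_of_real ?t = tau N d v q"
    by (rule tau_proj(1)[OF v qd q(2), symmetric])
  then have "c * of_real ?t + tau N d v (ds_mult N q (P Y)) = tau N d v (ds_mult N q (P ?X))"
    unfolding PX ds_mult_add[OF qd cq Pd[OF Y]]
    using ds_closed(3)[OF qd cq] ds_closed(3)[OF qd Pd[OF Y]]
    by (simp add: tau_add ds_mult_smult[OF qd qd] tau_smult[OF qd] qq)
  also have "cmod \<dots> \<le> ?t * ds_opnorm N (P ?X)"
    by (rule tau_proj_mult_le[OF v qd q(2) Pd[OF X]])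
  also have "\<dots> \<le> ?t * ds_opnorm N ?X"
    using P X unfolding cond_expectation_def by (intro mult_left_mono) auto
  also have "\<dots> \<le> ?t * sqrt ((cmod c)\<^sup>2 + (ds_opnorm N Y)\<^sup>2)"
  proof (intro mult_left_mono ds_opnorm_le N)
    fix k assume k: "k \<in> {1..N}"
    have "mat_opnorm (c \<cdot>\<^sub>m q k + Y k) \<le> sqrt ((cmod c)\<^sup>2 + (ds_opnorm N Y)\<^sup>2)"
      using dsum_carrier[OF qd k] q(2)[OF k] dsum_carrier[OF Y k] 0[OF k] opnorm_le_ds_opnorm[OF k]
      by (rule opnorm_proj_add)
    then show "mat_opnorm (?X k) \<le> sqrt ((cmod c)\<^sup>2 + (ds_opnorm N Y)\<^sup>2)"
      using k by (simp add: ds_add_def ds_smult_def)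
  qed simp
  finally show "cmod (c * of_real ?t + tau N d v (ds_mult N q (P Y))) \<le> ?t * sqrt ((cmod c)\<^sup>2 + (ds_opnorm N Y)\<^sup>2)" .
qed simp

lemma mat_adjoint_minus:
  fixes A B :: "complex mat"
  assumes "A \<in> carrier_mat n m" "B \<in> carrier_mat n m"
  shows "mat_adjoint (A - B) = mat_adjoint A - mat_adjoint B"
proof -
  have C: "A - B \<in> carrier_mat n m" using assms by auto
  have c: "mat_adjoint (A - B) \<in> carrier_mat m n" "mat_adjoint A - mat_adjoint B \<in> carrier_mat m n"
    "mat_adjoint B \<in> carrier_mat m n"
    using assms C by (auto intro!: mat_adjoint_carrier minus_carrier_mat)
  show ?thesis
    using c assms mat_adjoint_index[OF C] mat_adjoint_index[OF assms(1)] mat_adjoint_index[OF assms(2)]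
    by (intro eq_matI) (auto simp del: mat_adjoint_carrier)
qed

lemma mat_adjoint_one: "mat_adjoint (1\<^sub>m n) = (1\<^sub>m n :: complex mat)"
proof -
  have c: "mat_adjoint (1\<^sub>m n) \<in> carrier_mat n n" for n by (rule mat_adjoint_carrier) simp
  show ?thesis
    using mat_adjoint_index[of "1\<^sub>m n" n n] c[of n] by (intro eq_matI) (auto simp del: mat_adjoint_carrier)
qed

lemma mat_proj_compl:
  assumes q: "q \<in> carrier_mat n n" "mat_proj q"
  shows "mat_proj (1\<^sub>m n - q)" "(1\<^sub>m n - q) * q = 0\<^sub>m n n" "q * (1\<^sub>m n - q) = 0\<^sub>m n n"
proof -
  show 1: "(1\<^sub>m n - q) * q = 0\<^sub>m n n"
    using q by (subst minus_mult_distrib_mat[of _ n n]) (auto simp: mat_proj_def)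
  show 2: "q * (1\<^sub>m n - q) = 0\<^sub>m n n"
    using q by (subst mult_minus_distrib_mat[of _ n n]) (auto simp: mat_proj_def)
  have "(1\<^sub>m n - q) * (1\<^sub>m n - q) = 1\<^sub>m n * (1\<^sub>m n - q) - q * (1\<^sub>m n - q)"
    using q by (intro minus_mult_distrib_mat[of _ n n]) auto
  also have "\<dots> = 1\<^sub>m n - q" unfolding 2 using q by auto
  finally show "mat_proj (1\<^sub>m n - q)"
    using q by (simp add: mat_proj_def mat_adjoint_minus[of _ n n] mat_adjoint_one)
qed

text \<open>The trace form of bilinearity for projections of \<open>B\<close>. The complement of
  \<open>q\<close> has to lie in \<open>B\<close> as well, because the vanishing of the functional
  is needed for both projections.\<close>

lemma tau_cond_expectation_proj:
  assumes N: "1 \<le> N" and v: "\<And>k. k \<in> {1..N} \<Longrightarrow> 0 \<le> v k" and BA: "B \<subseteq> dsum N d"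
    and P: "cond_expectation N d B P" and tau: "\<And>X. X \<in> dsum N d \<Longrightarrow> tau N d v (P X) = tau N d v X"
    and q: "q \<in> B" "\<And>k. k \<in> {1..N} \<Longrightarrow> mat_proj (q k)"
    and q'B: "(\<lambda>k\<in>{1..N}. 1\<^sub>m (d k) - q k) \<in> B" and X: "X \<in> dsum N d"
  shows "tau N d v (ds_mult N q (P X)) = tau N d v (ds_mult N q X)"
proof -
  have qd: "q \<in> dsum N d" using q BA by auto
  note qc = dsum_carrier[OF qd] and Xc = dsum_carrier[OF X]
  have Pd: "P Z \<in> dsum N d" if "Z \<in> dsum N d" for Z
    using P that BA unfolding cond_expectation_def by blast
  define q' where "q' = (\<lambda>k\<in>{1..N}. 1\<^sub>m (d k) - q k)"
  have q'k: "q' k = 1\<^sub>m (d k) - q k" if "k \<in> {1..N}" for k using that by (simp add: q'_def)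
  have q'd: "q' \<in> dsum N d" using q'B BA by (auto simp: q'_def)
  note q'c = dsum_carrier[OF q'd]
  have q': "mat_proj (q' k)" if "k \<in> {1..N}" for k
    using mat_proj_compl(1)[OF qc q(2)] that by (simp add: q'k)
  define X1 where "X1 = ds_mult N (ds_mult N q X) q"
  \<comment> \<open>The parts \<open>q X q'\<close> and \<open>q' X\<close> are annihilated by
    \<open>q\<close> from the right and from the left respectively, so the functional of
    \<open>q\<close> kills both and keeps only \<open>q X q\<close>.\<close>
  define X2 where "X2 = ds_mult N (ds_mult N q X) q'"
  define X3 where "X3 = ds_mult N q' X"
  have qX: "ds_mult N q X \<in> dsum N d" using ds_closed[OF qd X] by blast
  have d: "X1 \<in> dsum N d" "X2 \<in> dsum N d" "X3 \<in> dsum N d"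
    unfolding X1_def X2_def X3_def using ds_closed(3)[OF qX qd] ds_closed(3)[OF qX q'd] ds_closed(3)[OF q'd X] by auto
  have d23: "ds_add N X2 X3 \<in> dsum N d" using ds_closed(1)[OF d(2,3)] .
  have X_eq: "X = ds_add N X1 (ds_add N X2 X3)"
  proof
    fix k show "X k = ds_add N X1 (ds_add N X2 X3) k"
    proof (cases "k \<in> {1..N}")
      case True
      note c = qc[OF True] Xc[OF True] q'c[OF True]
      have s: "q k + q' k = 1\<^sub>m (d k)" using c True by (auto simp: q'k intro!: eq_matI)
      have "q k * X k * q k + (q k * X k * q' k + q' k * X k) = q k * X k * (q k + q' k) + q' k * X k"
        using c by (subst mult_add_distrib_mat[of _ "d k" "d k" _ "d k"])
          (auto intro!: assoc_add_mat[symmetric, of _ "d k" "d k"])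
      also have "\<dots> = q k * X k + q' k * X k" unfolding s using c by simp
      also have "\<dots> = (q k + q' k) * X k"
        using c by (simp add: add_mult_distrib_mat[of _ "d k" "d k"])
      also have "\<dots> = X k" unfolding s using c by simp
      finally show ?thesis using True by (simp add: ds_add_def X1_def X2_def X3_def ds_mult_def)
    next
      case False
      then show ?thesis using X by (auto simp: ds_add_def dsum_def PiE_def extensional_def)
    qed
  qed
  define \<phi> where "\<phi> Z = tau N d v (ds_mult N q (P Z))" for Z
  have add: "tau N d v (ds_mult N q (P (ds_add N Z W))) = \<phi> Z + \<phi> W" if "Z \<in> dsum N d" "W \<in> dsum N d" for Z W
  proof -
    have "P (ds_add N Z W) = ds_add N (P Z) (P W)" using P that unfolding cond_expectation_def by blast
    then show ?thesis
      using ds_closed(3)[OF qd Pd[OF that(1)]] ds_closed(3)[OF qd Pd[OF that(2)]]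
      by (simp add: ds_mult_add[OF qd Pd[OF that(1)] Pd[OF that(2)]] tau_add \<phi>_def)
  qed
  have z2: "\<phi> X2 = 0" unfolding \<phi>_def
  proof (rule cond_expectation_annihilated[OF N v BA P q d(2)])
    fix k assume k: "k \<in> {1..N}"
    note c = qc[OF k] Xc[OF k] q'c[OF k]
    have "X2 k * q k = q k * X k * (q' k * q k)"
      using c k by (simp add: X2_def ds_mult_def assoc_mult_mat[of _ "d k" "d k" _ "d k" _ "d k"])
    then show "X2 k * q k = 0\<^sub>m (d k) (d k) \<or> q k * X2 k = 0\<^sub>m (d k) (d k)"
      using c mat_proj_compl(2)[OF c(1) q(2)[OF k]] by (simp add: q'k[OF k])
  qed
  have z3: "\<phi> X3 = 0" unfolding \<phi>_def
  proof (rule cond_expectation_annihilated[OF N v BA P q d(3)])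
    fix k assume k: "k \<in> {1..N}"
    note c = qc[OF k] Xc[OF k] q'c[OF k]
    have "q k * X3 k = q k * q' k * X k"
      using c k by (simp add: X3_def ds_mult_def assoc_mult_mat[of _ "d k" "d k" _ "d k" _ "d k"])
    then show "X3 k * q k = 0\<^sub>m (d k) (d k) \<or> q k * X3 k = 0\<^sub>m (d k) (d k)"
      using c mat_proj_compl(3)[OF c(1) q(2)[OF k]] by (simp add: q'k[OF k])
  qed
  have z1: "tau N d v (ds_mult N q' (P X1)) = 0"
  proof (rule cond_expectation_annihilated[OF N v BA P _ q' d(1)])
    show "q' \<in> B" using q'B by (simp add: q'_def)
    fix k assume k: "k \<in> {1..N}"
    note c = qc[OF k] Xc[OF k] q'c[OF k]
    have "X1 k * q' k = q k * X k * (q k * q' k)"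
      using c k by (simp add: X1_def ds_mult_def assoc_mult_mat[of _ "d k" "d k" _ "d k" _ "d k"])
    then show "X1 k * q' k = 0\<^sub>m (d k) (d k) \<or> q' k * X1 k = 0\<^sub>m (d k) (d k)"
      using c mat_proj_compl(3)[OF c(1) q(2)[OF k]] by (simp add: q'k[OF k])
  qed
  have "\<phi> X = \<phi> X1"
    using add[OF d(1) d23] add[OF d(2,3)] z2 z3 X_eq by (simp add: \<phi>_def)
  also have "\<phi> X1 = \<phi> X1 + tau N d v (ds_mult N q' (P X1))" by (simp add: z1)
  also have "\<dots> = tau N d v (ds_add N (ds_mult N q (P X1)) (ds_mult N q' (P X1)))"
    using ds_closed(3)[OF qd Pd[OF d(1)]] ds_closed(3)[OF q'd Pd[OF d(1)]] by (simp add: tau_add \<phi>_def)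
  also have "ds_add N (ds_mult N q (P X1)) (ds_mult N q' (P X1)) = P X1"
  proof
    fix k show "ds_add N (ds_mult N q (P X1)) (ds_mult N q' (P X1)) k = P X1 k"
    proof (cases "k \<in> {1..N}")
      case True
      note c = qc[OF True] q'c[OF True] dsum_carrier[OF Pd[OF d(1)] True]
      have s: "q k + q' k = 1\<^sub>m (d k)" using c True by (auto simp: q'k intro!: eq_matI)
      have "q k * P X1 k + q' k * P X1 k = (q k + q' k) * P X1 k"
        using c by (simp add: add_mult_distrib_mat[of _ "d k" "d k"])
      then show ?thesis using True c unfolding s by (simp add: ds_add_def ds_mult_def)
    next
      case False
      then show ?thesis using Pd[OF d(1)] by (auto simp: ds_add_def dsum_def PiE_def extensional_def)
    qed
  qed
  also have "tau N d v (P X1) = tau N d v X1" by (rule tau[OF d(1)])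
  also have "\<dots> = tau N d v (ds_mult N q X)"
    unfolding tau_def
  proof (intro sum.cong refl)
    fix k assume k: "k \<in> {1..N}"
    note c = qc[OF k] Xc[OF k]
    have "mat_trace (q k * X k * q k) = mat_trace (q k * (q k * X k))"
      using c by (intro mat_trace_mult_comm[where n = "d k"]) auto
    also have "q k * (q k * X k) = q k * X k"
      using c q(2)[OF k] by (simp add: mat_proj_def flip: assoc_mult_mat[of _ "d k" "d k" _ "d k" _ "d k"])
    finally show "complex_of_real (v k / real (d k)) * mat_trace (X1 k) = complex_of_real (v k / real (d k)) * mat_trace (ds_mult N q X k)"
      using k by (simp add: X1_def ds_mult_def)
  qed
  finally show ?thesis by (simp add: \<phi>_def)
qed

text \<open>Both maps give \<open>tau (q * P X) = tau (q * X)\<close> for every projection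
  \<open>q\<close> of \<open>B\<close>. Projections supported in one summand turn this into an
  equation between traces in that summand, where projections separate points.\<close>

lemma cond_expectation_unique:
  assumes N: "1 \<le> N" and lam: "\<And>k. k \<in> {1..N} \<Longrightarrow> refined_partition (lam k) (d k)"
    and v: "\<And>k. k \<in> {1..N} \<Longrightarrow> 0 < v k" and d: "\<And>k. k \<in> {1..N} \<Longrightarrow> 0 < d k"
    and P: "cond_expectation N d (ds_subalgebra N lam) P" "\<And>X. X \<in> dsum N d \<Longrightarrow> tau N d v (P X) = tau N d v X"
    and P': "cond_expectation N d (ds_subalgebra N lam) P'" "\<And>X. X \<in> dsum N d \<Longrightarrow> tau N d v (P' X) = tau N d v X"
  shows "P = P'"
proof
  fix X
  let ?B = "ds_subalgebra N lam"
  have BA: "?B \<subseteq> dsum N d"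
    unfolding ds_subalgebra_def dsum_def using block_subalgebra_carrier[OF lam] by (intro PiE_mono) auto
  show "P X = P' X"
  proof (cases "X \<in> dsum N d")
    \<comment> \<open>Outside the algebra both maps are \<open>undefined\<close>, by the extensional
      function space.\<close>
    case False
    then show ?thesis using P(1) P'(1) by (auto simp: cond_expectation_def PiE_def extensional_def)
  next
    case True
    have B: "P X \<in> ?B" "P' X \<in> ?B" using P(1) P'(1) True unfolding cond_expectation_def by auto
    have "P X k = P' X k" if k: "k \<in> {1..N}" for k
    proof -
      have PB: "P X k \<in> block_subalgebra (lam k)" "P' X k \<in> block_subalgebra (lam k)"
        using B k by (auto simp: ds_subalgebra_def)
      then have c: "P X k \<in> carrier_mat (d k) (d k)" "P' X k \<in> carrier_mat (d k) (d k)"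
        using block_subalgebra_carrier[OF lam[OF k]] by auto
      have "P X k - P' X k = 0\<^sub>m (d k) (d k)"
      proof (rule block_subalgebra_separation[OF lam[OF k] diff_in_block_subalgebra[OF lam[OF k] PB]])
        fix q0 assume q0: "q0 \<in> block_subalgebra (lam k)" "mat_adjoint q0 = q0" "q0 * q0 = q0"
        have q0c: "q0 \<in> carrier_mat (d k) (d k)" using q0 block_subalgebra_carrier[OF lam[OF k]] by auto
        \<comment> \<open>Extension by zero keeps only the summand \<open>k\<close> of
          \<open>tau\<close>.\<close>
        define q where "q = (\<lambda>j\<in>{1..N}. if j = k then q0 else 0\<^sub>m (d j) (d j))"
        have adj0: "mat_adjoint (0\<^sub>m n n) = (0\<^sub>m n n :: complex mat)" for n
          using mat_adjoint_index[of "0\<^sub>m n n" n n] mat_adjoint_carrier[of "0\<^sub>m n n" n n]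
          by (intro eq_matI) (auto simp del: mat_adjoint_carrier)
        have qB: "q \<in> ?B" using q0(1) zero_in_block_subalgebra[OF lam] by (auto simp: q_def ds_subalgebra_def)
        have qp: "mat_proj (q j)" if "j \<in> {1..N}" for j
          using q0 that by (auto simp: q_def mat_proj_def adj0)
        have qB': "(\<lambda>j\<in>{1..N}. 1\<^sub>m (d j) - q j) \<in> ?B"
          using qB one_in_block_subalgebra[OF lam] by (auto simp: ds_subalgebra_def intro!: diff_in_block_subalgebra lam)
        have tq: "tau N d v (ds_mult N q Z) = of_real (v k / d k) * mat_trace (q0 * Z k)" if "Z \<in> dsum N d" for Z
        proof -
          have "tau N d v (ds_mult N q Z) = (\<Sum>j=1..N. if j = k then of_real (v k / d k) * mat_trace (q0 * Z k) else 0)"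
            unfolding tau_def using left_mult_zero_mat[OF dsum_carrier[OF that]]
            by (intro sum.cong) (auto simp: ds_mult_def q_def mat_trace_def)
          then show ?thesis using k by simp
        qed
        have v0: "\<And>j. j \<in> {1..N} \<Longrightarrow> 0 \<le> v j" using v less_imp_le by blast
        have "tau N d v (ds_mult N q (P X)) = tau N d v (ds_mult N q (P' X))"
        proof (rule trans)
          show "tau N d v (ds_mult N q (P X)) = tau N d v (ds_mult N q X)"
            by (rule tau_cond_expectation_proj[OF N v0 BA P qB qp qB' True])
          show "tau N d v (ds_mult N q X) = tau N d v (ds_mult N q (P' X))"
            by (rule tau_cond_expectation_proj[OF N v0 BA P' qB qp qB' True, symmetric])
        qed
        \<comment> \<open>The weight \<open>v k / d k\<close> is positive and can be
          cancelled.\<close>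
        then have "mat_trace (q0 * P X k) = mat_trace (q0 * P' X k)"
          using tq[OF subsetD[OF BA B(1)]] tq[OF subsetD[OF BA B(2)]] v[OF k] d[OF k] by simp
        moreover have "q0 * (P X k - P' X k) + q0 * P' X k = q0 * P X k"
          using c q0c by (subst mult_minus_distrib_mat[of _ "d k" "d k" _ "d k"]) (auto intro!: eq_matI)
        then have "mat_trace (q0 * P X k) = mat_trace (q0 * (P X k - P' X k)) + mat_trace (q0 * P' X k)"
          using c q0c mat_trace_add[of "q0 * (P X k - P' X k)" "d k" "q0 * P' X k"] mult_carrier_mat[OF q0c c(2)]
            mult_carrier_mat[OF q0c minus_carrier_mat[OF c(2)]] by simp
        ultimately show "mat_trace (q0 * (P X k - P' X k)) = 0" by simp
      qed
      then have "(P X k - P' X k) + P' X k = P' X k" using c by simp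
      moreover have "(P X k - P' X k) + P' X k = P X k" using c by (intro eq_matI) auto
      ultimately show ?thesis by simp
    qed
    then show ?thesis using B unfolding ds_subalgebra_def by (intro PiE_ext) auto
  qed
qed

subsection \<open>Existence and the norm estimate\<close>

text \<open>The block averages act in each summand separately and preserve each trace, which gives
  \<open>tau\<close> term by term. The lower bound stays attached to its summand, with the number of
  blocks of that summand.\<close>

lemma ex_cond_expectation:
  assumes N: "1 \<le> N" and lam: "\<And>k. k \<in> {1..N} \<Longrightarrow> refined_partition (lam k) (d k)"
    and M: "\<And>k n m. k \<in> {1..N} \<Longrightarrow> (n, m) \<in> set (lam k) \<Longrightarrow> m \<le> M"
  shows "\<exists>P. cond_expectation N d (ds_subalgebra N lam) P \<and>
    (\<forall>X\<in>dsum N d. tau N d v (P X) = tau N d v X) \<and>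
    (\<forall>X\<in>dsum N d. \<forall>k\<in>{1..N}. psd (X k) \<longrightarrow>
       mat_opnorm (X k) \<le> real (\<Sum>(n, m)\<leftarrow>lam k. m) * real M * mat_opnorm (P X k))"
proof -
  have "\<forall>k\<in>{1..N}. \<exists>E. (\<forall>X. E X \<in> block_subalgebra (lam k)) \<and>
    (\<forall>X\<in>carrier_mat (d k) (d k). \<forall>Y\<in>carrier_mat (d k) (d k). E (X + Y) = E X + E Y) \<and>
    (\<forall>c. \<forall>X\<in>carrier_mat (d k) (d k). E (c \<cdot>\<^sub>m X) = c \<cdot>\<^sub>m E X) \<and>
    (\<forall>X\<in>block_subalgebra (lam k). E X = X) \<and>
    (\<forall>X\<in>carrier_mat (d k) (d k). mat_trace (E X) = mat_trace X) \<and>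
    (\<forall>X\<in>carrier_mat (d k) (d k). mat_opnorm (E X) \<le> mat_opnorm X) \<and>
    (\<forall>X\<in>carrier_mat (d k) (d k). psd X \<longrightarrow>
       mat_opnorm X \<le> real (\<Sum>(n, m)\<leftarrow>lam k. m) * real M * mat_opnorm (E X))"
    (is "\<forall>k\<in>_. \<exists>E. ?E k E")
  proof
    fix k assume k: "k \<in> {1..N}"
    show "\<exists>E. ?E k E" by (rule ex_block_average[OF lam[OF k]]) (rule M[OF k])
  qed
  from bchoice[OF this] obtain E where "\<forall>k\<in>{1..N}. ?E k (E k)" by auto
  then have E0: "\<And>k. k \<in> {1..N} \<Longrightarrow> ?E k (E k)" by blast
  note E = E0[THEN conjunct1, rule_format]
    E0[THEN conjunct2, THEN conjunct1, rule_format]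
    E0[THEN conjunct2, THEN conjunct2, THEN conjunct1, rule_format]
    E0[THEN conjunct2, THEN conjunct2, THEN conjunct2, THEN conjunct1, rule_format]
    E0[THEN conjunct2, THEN conjunct2, THEN conjunct2, THEN conjunct2, THEN conjunct1, rule_format]
    E0[THEN conjunct2, THEN conjunct2, THEN conjunct2, THEN conjunct2, THEN conjunct2, THEN conjunct1, rule_format]
    E0[THEN conjunct2, THEN conjunct2, THEN conjunct2, THEN conjunct2, THEN conjunct2, THEN conjunct2, rule_format]
  define P where "P = (\<lambda>X\<in>dsum N d. \<lambda>k\<in>{1..N}. E k (X k))"
  have P: "P X k = E k (X k)" if "X \<in> dsum N d" "k \<in> {1..N}" for X k
    using that by (simp add: P_def)
  have PX: "P X = (\<lambda>k\<in>{1..N}. E k (X k))" if "X \<in> dsum N d" for X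
    using that by (simp add: P_def)
  have BA: "ds_subalgebra N lam \<subseteq> dsum N d"
    unfolding ds_subalgebra_def dsum_def using block_subalgebra_carrier[OF lam] by (intro PiE_mono) auto
  have "cond_expectation N d (ds_subalgebra N lam) P"
    unfolding cond_expectation_def
  proof (intro conjI ballI allI)
    show "P \<in> dsum N d \<rightarrow>\<^sub>E ds_subalgebra N lam"
      unfolding P_def using E(1) by (auto simp: ds_subalgebra_def)
  next
    fix X Y assume XY: "X \<in> dsum N d" "Y \<in> dsum N d"
    show "P (ds_add N X Y) = ds_add N (P X) (P Y)"
      unfolding PX[OF ds_closed(1)[OF XY]] PX[OF XY(1)] PX[OF XY(2)] unfolding ds_add_def
      using E(2)[OF _ dsum_carrier[OF XY(1)] dsum_carrier[OF XY(2)]] by (intro restrict_ext) auto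
  next
    fix c X assume X: "X \<in> dsum N d"
    show "P (ds_smult N c X) = ds_smult N c (P X)"
      unfolding PX[OF ds_closed(2)[OF X X]] PX[OF X] unfolding ds_smult_def
      using E(3)[OF _ dsum_carrier[OF X]] by (intro restrict_ext) auto
  next
    fix X assume X: "X \<in> ds_subalgebra N lam"
    then have Xd: "X \<in> dsum N d" using BA by blast
    show "P X = X"
      unfolding PX[OF Xd]
    proof
      fix k show "(\<lambda>k\<in>{1..N}. E k (X k)) k = X k"
      proof (cases "k \<in> {1..N}")
        case True
        then have "X k \<in> block_subalgebra (lam k)" using X by (auto simp: ds_subalgebra_def)
        then show ?thesis using True E(4) by simp
      next
        case False
        then show ?thesis using Xd by (auto simp: dsum_def PiE_def extensional_def)
      qed
    qed
  next
    fix X assume X: "X \<in> dsum N d"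
    show "ds_opnorm N (P X) \<le> ds_opnorm N X"
    proof (rule ds_opnorm_le[OF N])
      fix k assume k: "k \<in> {1..N}"
      show "mat_opnorm (P X k) \<le> ds_opnorm N X"
        unfolding P[OF X k] by (rule order_trans[OF E(6)[OF k dsum_carrier[OF X k]] opnorm_le_ds_opnorm[OF k, of X]])
    qed
  qed
  moreover have "tau N d v (P X) = tau N d v X" if X: "X \<in> dsum N d" for X
    unfolding tau_def using E(5)[OF _ dsum_carrier[OF X]] by (intro sum.cong) (auto simp: P X)
  moreover have "mat_opnorm (X k) \<le> real (\<Sum>(n, m)\<leftarrow>lam k. m) * real M * mat_opnorm (P X k)"
    if "X \<in> dsum N d" "k \<in> {1..N}" "psd (X k)" for X k
    using E(7)[OF that(2) dsum_carrier[OF that(1,2)] that(3)] that by (simp add: P)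
  ultimately show ?thesis by blast
qed

text \<open>A divisor of a positive number is at most that number. The \<open>Lcm\<close> of an
  infinite set or of a set containing 0 is 0, which accounts for the hypotheses.\<close>

lemma le_Lcm_nat:
  fixes A :: "nat set"
  assumes "finite A" "0 \<notin> A" "m \<in> A"
  shows "m \<le> Lcm A"
proof (rule dvd_imp_le)
  show "m dvd Lcm A" using assms(3) by (rule dvd_Lcm)
  have "Lcm A \<noteq> 0" using assms by (simp add: Lcm_0_iff)
  then show "0 < Lcm A" by simp
qed

theorem theorem4p9:
  fixes N :: nat and d :: "nat \<Rightarrow> nat" and lam :: "nat \<Rightarrow> rpart" and v :: "nat \<Rightarrow> real"
    and B :: "mats set" and l r :: nat
  assumes N: "1 \<le> N"
    and lam: "\<And>k. k \<in> {1..N} \<Longrightarrow> refined_partition (lam k) (d k)"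
    and B: "B = ds_subalgebra N lam"
    and v: "if N = 1 then v 1 = 1 else (\<forall>k\<in>{1..N}. 0 < v k \<and> v k < 1)"
    and v_sum: "(\<Sum>k=1..N. v k) = 1"
    and l: "l = Lcm {m. \<exists>k\<in>{1..N}. \<exists>n. (n, m) \<in> set (lam k)}"
    and r: "r = Lcm ((\<lambda>k. \<Sum>(n, m)\<leftarrow>lam k. m) ` {1..N})"
  shows "(\<forall>X\<in>dsum N d. ds_positive N X \<longrightarrow>
            ds_opnorm N (cond_exp N d v B X) \<ge> 1 / (real r * real l) * ds_opnorm N X)
       \<and> (\<forall>X\<in>dsum N d.
            1 / sqrt (real r * real l) * ds_opnorm N X \<le> FR_norm N d v B X)"
proof -
  have vpos: "0 < v k" if "k \<in> {1..N}" for k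
    using v that by (cases "N = 1") auto
  have part: "lam k \<noteq> []" "\<And>n m. (n, m) \<in> set (lam k) \<Longrightarrow> 1 \<le> n \<and> 1 \<le> m"
    "d k = (\<Sum>(n, m)\<leftarrow>lam k. m * n)" if "k \<in> {1..N}" for k
    using lam[OF that] unfolding refined_partition_def by auto
  have pos: "0 < d k" "0 < (\<Sum>(n, m)\<leftarrow>lam k. m)" if k: "k \<in> {1..N}" for k
  proof -
    obtain n m where nm: "(n, m) \<in> set (lam k)" using part(1)[OF k] by (metis last_in_set prod.collapse)
    then have "1 \<le> n" "1 \<le> m" using part(2)[OF k] by auto
    moreover have "m * n \<le> (\<Sum>(n, m)\<leftarrow>lam k. m * n)" "m \<le> (\<Sum>(n, m)\<leftarrow>lam k. m)"
      using nm by (force intro: member_le_sum_list)+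
    ultimately show "0 < d k" "0 < (\<Sum>(n, m)\<leftarrow>lam k. m)" using part(3)[OF k] by (auto intro: Nat.gr0I)
  qed
  have "{m. \<exists>k\<in>{1..N}. \<exists>n. (n, m) \<in> set (lam k)} = (\<Union>k\<in>{1..N}. snd ` set (lam k))" by force
  then have fin: "finite {m. \<exists>k\<in>{1..N}. \<exists>n. (n, m) \<in> set (lam k)}" by simp
  have ml: "m \<le> l" if "k \<in> {1..N}" "(n, m) \<in> set (lam k)" for k n m
    unfolding l
  proof (rule le_Lcm_nat[OF fin])
    show "0 \<notin> {m. \<exists>k\<in>{1..N}. \<exists>n. (n, m) \<in> set (lam k)}"
    proof
      assume "0 \<in> {m. \<exists>k\<in>{1..N}. \<exists>n. (n, m) \<in> set (lam k)}"
      then obtain k n where "k \<in> {1..N}" "(n, 0) \<in> set (lam k)" by blast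
      from part(2)[OF this] show False by simp
    qed
  qed (use that in blast)
  have rl: "(\<Sum>(n, m)\<leftarrow>lam k. m) \<le> r" if "k \<in> {1..N}" for k
    unfolding r
  proof (rule le_Lcm_nat)
    show "0 \<notin> (\<lambda>k. \<Sum>(n, m)\<leftarrow>lam k. m) ` {1..N}"
    proof
      assume "0 \<in> (\<lambda>k. \<Sum>(n, m)\<leftarrow>lam k. m) ` {1..N}"
      then obtain k where "k \<in> {1..N}" "0 = (\<Sum>(n, m)\<leftarrow>lam k. m)" by blast
      with pos(2)[of k] show False by simp
    qed
  qed (use that in auto)
  obtain P where P: "cond_expectation N d B P" "\<And>X. X \<in> dsum N d \<Longrightarrow> tau N d v (P X) = tau N d v X"
    and bound: "\<And>X k. X \<in> dsum N d \<Longrightarrow> k \<in> {1..N} \<Longrightarrow> psd (X k) \<Longrightarrow>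
       mat_opnorm (X k) \<le> real (\<Sum>(n, m)\<leftarrow>lam k. m) * real l * mat_opnorm (P X k)"
  proof -
    have "\<exists>P. cond_expectation N d (ds_subalgebra N lam) P \<and>
      (\<forall>X\<in>dsum N d. tau N d v (P X) = tau N d v X) \<and>
      (\<forall>X\<in>dsum N d. \<forall>k\<in>{1..N}. psd (X k) \<longrightarrow>
         mat_opnorm (X k) \<le> real (\<Sum>(n, m)\<leftarrow>lam k. m) * real l * mat_opnorm (P X k))"
      by (rule ex_cond_expectation[OF N lam ml])
    with that show thesis unfolding B by blast
  qed
  have "cond_exp N d v B = P"
    unfolding cond_exp_def
  proof (rule the_equality)
    fix Q assume "cond_expectation N d B Q \<and> (\<forall>X\<in>dsum N d. tau N d v (Q X) = tau N d v X)"
    then have Q: "cond_expectation N d B Q" "\<And>X. X \<in> dsum N d \<Longrightarrow> tau N d v (Q X) = tau N d v X" by auto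
    show "Q = P"
      using N lam vpos pos(1) Q[unfolded B] P[unfolded B] by (rule cond_expectation_unique)
  qed (use P in auto)
  \<comment> \<open>The two quotients in the claim are thus genuine and not divisions by 0.\<close>
  have "1 \<le> r * l"
  proof -
    have k: "1 \<in> {1..N}" using N by simp
    obtain n m where nm: "(n, m) \<in> set (lam 1)" using part(1)[OF k] by (metis last_in_set prod.collapse)
    have "1 \<le> l" using ml[OF k nm] part(2)[OF k nm] by linarith
    moreover have "1 \<le> r" using rl[OF k] pos(2)[OF k] by linarith
    ultimately show ?thesis by simp
  qed
  then have rlpos: "0 < real r * real l" by (simp add: of_nat_mult[symmetric] del: of_nat_mult)
  have BA: "B \<subseteq> dsum N d"
    unfolding B ds_subalgebra_def dsum_def using block_subalgebra_carrier[OF lam] by (intro PiE_mono) auto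
  have main: "ds_opnorm N X \<le> real r * real l * ds_opnorm N (P X)"
    if X: "X \<in> dsum N d" "ds_positive N X" for X
  proof (rule ds_opnorm_le[OF N])
    fix k assume k: "k \<in> {1..N}"
    have "P X \<in> dsum N d" using P(1) X(1) BA unfolding cond_expectation_def by blast
    then have "0 \<le> mat_opnorm (P X k)" using dsum_carrier k mat_opnorm_nonneg by blast
    have "mat_opnorm (X k) \<le> real (\<Sum>(n, m)\<leftarrow>lam k. m) * real l * mat_opnorm (P X k)"
      using bound X k unfolding ds_positive_def by blast
    also have "\<dots> \<le> real r * real l * ds_opnorm N (P X)"
      using rl[OF k] opnorm_le_ds_opnorm[OF k, of "P X"] \<open>0 \<le> mat_opnorm (P X k)\<close>
      by (intro mult_mono mult_right_mono of_nat_mono mult_nonneg_nonneg) simp_all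
    finally show "mat_opnorm (X k) \<le> real r * real l * ds_opnorm N (P X)" .
  qed
  show ?thesis
    unfolding FR_norm_def \<open>cond_exp N d v B = P\<close>
  proof (intro conjI ballI impI)
    fix X assume "X \<in> dsum N d" "ds_positive N X"
    from main[OF this] show "1 / (real r * real l) * ds_opnorm N X \<le> ds_opnorm N (P X)"
      using rlpos by (simp add: field_simps)
  next
    fix X assume X: "X \<in> dsum N d"
    let ?Y = "ds_mult N (ds_adjoint N X) X"
    have Y: "?Y \<in> dsum N d" using ds_closed(3)[OF ds_closed(4)[OF X X] X] .
    have Yk: "?Y k = mat_adjoint (X k) * X k" if "k \<in> {1..N}" for k
      using that by (simp add: ds_mult_def ds_adjoint_def)
    have "ds_positive N ?Y"
      unfolding ds_positive_def using psd_adjoint_mult[OF dsum_carrier[OF X]] Yk by auto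
    have "ds_opnorm N X \<le> sqrt (ds_opnorm N ?Y)"
    proof (intro ds_opnorm_le N real_le_rsqrt)
      fix k assume k: "k \<in> {1..N}"
      have "(mat_opnorm (X k))\<^sup>2 \<le> mat_opnorm (?Y k)"
        unfolding Yk[OF k] by (rule opnorm_sq_le[OF dsum_carrier[OF X k]])
      also have "\<dots> \<le> ds_opnorm N ?Y" by (rule opnorm_le_ds_opnorm[OF k])
      finally show "(mat_opnorm (X k))\<^sup>2 \<le> ds_opnorm N ?Y" .
    qed
    \<comment> \<open>The lower bound for the positive element \<open>?Y\<close>, under the square
      root.\<close>
    also have "\<dots> \<le> sqrt (real r * real l) * sqrt (ds_opnorm N (P ?Y))"
      using main[OF Y \<open>ds_positive N ?Y\<close>] by (simp flip: real_sqrt_mult)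
    finally show "1 / sqrt (real r * real l) * ds_opnorm N X \<le> sqrt (ds_opnorm N (P ?Y))"
      using rlpos by (simp add: field_simps)
  qed
qed

end
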